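(* Let $(s_n)_{n \geq 1}$ be a sequence of independent random variables, each uniformly distributed in $\{-1, +1\}$. Then \[ \mathbb{E}\big[\log \operatorname{lcm} (L_1 + s_1, L_2 + s_2, \dots, L_n + s_n)\big] \sim C \cdot \frac{\log \alpha}{\pi^2} \cdot n^2 \qquad (n \to +\infty), \] where \[ C := \tfrac{243}{128} + \tfrac{27}{8}\operatorname{Li}_2\!\big(\tfrac1{4}\big) + \tfrac{9}{8}\operatorname{Li}_2\!\big(\tfrac1{16}\big) + \tfrac{3}{16}\operatorname{Li}_2\!\big(\tfrac1{16}; \tfrac1{3}\big) + \tfrac{3}{32}\operatorname{Li}_2\!\big(\tfrac1{16}; \tfrac{2}{3}\big), \] and zero terms in the least common multiple are ignored.
   Context: $(L_n)_{n \geq 1}$ is the sequence of Lucas numbers: $L_1 = 1$, $L_2 = 3$, $L_{n+2} = L_{n+1} + L_n$. $\alpha = (1+\sqrt5)/2$. $\operatorname{Li}_2(z) := \sum_{n=1}^\infty z^n/n^2$ and $\operatorname{Li}_2(z; a) := \sum_{n=1}^\infty z^n/(n+a)^2$. $f(n) \sim g(n)$ means $f(n)/g(n) \to 1$. *)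

theory Defs
  imports "HOL-Probability.Probability" "HOL-Library.Landau_Symbols"
begin

text \<open>
  Only the values at positive indices are used below; the value at 0 is the one that makes the
  recurrence hold there too.
\<close>
fun lucas :: "nat \<Rightarrow> int" where
  "lucas 0 = 2"
| "lucas (Suc 0) = 1"
| "lucas (Suc (Suc n)) = lucas (Suc n) + lucas n"

lemma lucas_2: "lucas 2 = 3"
  by (simp add: numeral_2_eq_2)

definition golden_ratio :: real where
  "golden_ratio = (1 + sqrt 5) / 2"

text \<open>
  Both series start at index 1, hence the shift to \<open>Suc n\<close>.  They are meant for
  \<open>norm z < 1\<close>, where they converge absolutely.
\<close>
definition Li2 :: "'a :: {real_normed_field, banach} \<Rightarrow> 'a" where
  "Li2 z = (\<Sum>n. z ^ Suc n / of_nat (Suc n) ^ 2)"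

definition Li2_shifted :: "'a :: {real_normed_field, banach} \<Rightarrow> 'a \<Rightarrow> 'a" where
  "Li2_shifted z a = (\<Sum>n. z ^ Suc n / (of_nat (Suc n) + a) ^ 2)"

definition lucas_lcm_const :: real where
  "lucas_lcm_const = 243 / 128 + 27 / 8 * Li2 (1 / 4) + 9 / 8 * Li2 (1 / 16)
     + 3 / 16 * Li2_shifted (1 / 16) (1 / 3) + 3 / 32 * Li2_shifted (1 / 16) (2 / 3)"

text \<open>
  The least common multiple of the nonzero numbers among \<open>lucas k + t k\<close> for \<open>1 \<le> k \<le> n\<close>
  (nonnegative by the normalisation of \<open>Lcm\<close> on the integers, and 1 if there are none).
\<close>
definition shifted_lucas_lcm :: "(nat \<Rightarrow> int) \<Rightarrow> nat \<Rightarrow> int" where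
  "shifted_lucas_lcm t n = Lcm ((\<lambda>k. lucas k + t k) ` {1..n} - {0})"

end

theory Submission
  imports Defs "HOL-Number_Theory.Fib" "HOL-Computational_Algebra.Squarefree" "HOL-Real_Asymp.Real_Asymp"
begin

text \<open>
  Write \<open>F\<close> for the Fibonacci numbers and let \<open>P d\<close> be the part of \<open>F d\<close> composed of the primes
  whose rank of apparition is \<open>d\<close>.  The \<open>P d\<close> are pairwise coprime, and lifting the exponent shows
  that \<open>F n\<close> is the product of the \<open>P d\<close> over \<open>d dvd n\<close> up to a factor at most \<open>n\<^sup>2\<close>.
  Each number \<open>L n + s\<close> with \<open>s = 1\<close> or \<open>s = -1\<close> is \<open>1\<close> or \<open>5\<close> times an explicit quotient of products
  of Fibonacci numbers, so up to a polynomial factor it is the product of \<open>P d\<close> over an explicit set of indices \<open>d\<close>.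
  Hence \<open>ln lcm\<close> is the sum of \<open>ln (P d)\<close> over the union of these sets, up to \<open>O(n ln n)\<close>.

  For \<open>d \<ge> 3\<close> and given \<open>k\<close>, at most one of the two signs puts \<open>d\<close> into the index set of \<open>L k + s\<close>,
  so \<open>d\<close> is missed with probability \<open>2\<close> to the power minus the number of \<open>k \<le> n\<close> for which
  some sign does.  This number depends on \<open>d\<close> only through \<open>lcm d 2\<close> and whether \<open>3 dvd d\<close>.
  Partial sums of \<open>ln (P d)\<close> are found by Moebius inversion from
  \<open>ln (F m) = m ln \<alpha> + O(1)\<close>, and Tannery's theorem sums the resulting series.
\<close>

section \<open>Primitive parts of Fibonacci numbers\<close>

text \<open>Origin of the constant. Write \<open>lcm d 2 = 2 * e\<close> and q = 3 n div (2 e).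
  Unless 2 e divides n or n + 1, the number of indices at which some sign brings in d is q + q div 3
  if 3 divides e, and 2 (q div 3) otherwise. When q grows by 3, the probability of missing d thus
  shrinks by a factor 1/16 or 1/4; these are the arguments of the dilogarithms, and the shifts 1/3
  and 2/3 come from the residues of q modulo 3. The two classes of e must therefore be summed
  separately: up to x they carry 3/2 and 9/2 times x^2 ln \<alpha> / pi^2. Abel summation over the
  values of q evaluates these sums at x = 3 n / (2 j), whence a further factor 9/4.\<close>

definition fib_prim :: "nat \<Rightarrow> nat" where
  "fib_prim d = (\<Prod>p\<in>{p \<in> prime_factors (fib d). \<forall>e. 0 < e \<and> e < d \<longrightarrow> \<not> p dvd fib e}.
      p ^ multiplicity p (fib d))"

lemma not_coprime_nat_ex_prime:
  fixes a b :: nat assumes "\<not> coprime a b"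
  shows "\<exists>p. prime p \<and> p dvd a \<and> p dvd b"
proof -
  have "gcd a b \<noteq> 1" using assms unfolding coprime_iff_gcd_eq_1 .
  from prime_factor_nat[OF this] show ?thesis by simp
qed

lemma fib_pos_iff: "fib n > 0 \<longleftrightarrow> n > 0"
  using fib_neq_0_nat[of n] by (cases n) auto

lemma fib_dvd_fib: "d dvd n \<Longrightarrow> fib d dvd fib n"
  by (metis fib_gcd gcd_nat.absorb1 gcd_dvd2)

lemma fib_prim_pos: "fib_prim d > 0"
  unfolding fib_prim_def by (intro prod_pos) (auto intro: prime_gt_0_nat)

lemma fib_prim_dvd_fib: "fib_prim d dvd fib d"
proof (cases "d = 0")
  case False
  then have "fib d = (\<Prod>p\<in>prime_factors (fib d). p ^ multiplicity p (fib d))"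
    by (intro prime_factorization_nat) (simp add: fib_neq_0_nat)
  moreover have "fib_prim d dvd (\<Prod>p\<in>prime_factors (fib d). p ^ multiplicity p (fib d))"
    unfolding fib_prim_def by (intro prod_dvd_prod_subset) auto
  ultimately show ?thesis by simp
qed (simp add: fib_prim_def)

text \<open>The rank of apparition at work: p divides F (gcd d n), because gcd commutes with F, and
  no positive index below d is possible, so gcd d n = d.\<close>

lemma prime_dvd_fib_prim:
  assumes p: "prime p" "p dvd fib_prim d" and d: "d > 0" and n: "p dvd fib n"
  shows "d dvd n"
proof -
  obtain q where q: "q \<in> prime_factors (fib d)" "\<forall>e. 0 < e \<and> e < d \<longrightarrow> \<not> q dvd fib e"
    "p dvd q ^ multiplicity q (fib d)"
    using p unfolding fib_prim_def by (subst (asm) prime_dvd_prod_iff) auto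
  then have "p = q"
    using p(1) by (metis in_prime_factors_imp_prime prime_dvd_power primes_dvd_imp_eq)
  with q have pd: "p dvd fib d" and low: "\<forall>e. 0 < e \<and> e < d \<longrightarrow> \<not> p dvd fib e"
    by auto
  have "p dvd fib (gcd d n)" using pd n by (simp add: fib_gcd)
  moreover have "gcd d n > 0" "gcd d n \<le> d" using d by (auto intro: dvd_imp_le)
  ultimately have "gcd d n = d" using low by (metis le_neq_implies_less)
  then show ?thesis by (metis gcd_dvd2)
qed

lemma coprime_fib_prim_fib: "d > 0 \<Longrightarrow> \<not> d dvd n \<Longrightarrow> coprime (fib_prim d) (fib n)"
  using not_coprime_nat_ex_prime[of "fib_prim d" "fib n"] prime_dvd_fib_prim[of _ d n] by metis

lemma coprime_fib_prim:
  assumes "d > 0" "e > 0" "d \<noteq> e"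
  shows "coprime (fib_prim d) (fib_prim e)"
proof -
  have *: "coprime (fib_prim a) (fib_prim b)" if "a > 0" "\<not> a dvd b" for a b
    using coprime_fib_prim_fib[OF that] coprime_divisors[OF dvd_refl fib_prim_dvd_fib[of b]] by blast
  have "\<not> d dvd e \<or> \<not> e dvd d" using assms dvd_antisym by blast
  then show ?thesis
    using *[of d e] *[of e d] assms by (auto simp: coprime_commute)
qed

text \<open>
  Modulo \<open>F\<^sup>3\<close> with \<open>F = fib (Suc r)\<close>, this is the binomial expansion of
  \<open>(F \<alpha> + fib r) ^ k\<close>, which equals \<open>\<alpha> ^ (Suc r * k)\<close>, with \<open>k = j + 2\<close>.
  The third order is needed to bound \<open>p\<close>-adic valuations when \<open>p\<close> divides \<open>F\<close> only once.
\<close>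
lemma fib_mult_expansion:
  "\<exists>t u. int (fib (Suc r * (j + 2))) =
       int (j + 2) * int (fib (Suc r)) * int (fib r) ^ (j + 1)
       + int ((j + 2) choose 2) * int (fib (Suc r)) ^ 2 * int (fib r) ^ j + int (fib (Suc r)) ^ 3 * t
     \<and> int (fib (Suc (Suc r * (j + 2)))) =
       int (fib r) ^ (j + 2) + int (j + 2) * int (fib (Suc r)) * int (fib r) ^ (j + 1)
       + int (fib (Suc r)) ^ 2 * u"
proof (induction j)
  case 0
  define f g where "f = int (fib (Suc r))" and "g = int (fib r)"
  define X Z where "X = int (fib (Suc r * (0 + 2)))" and "Z = int (fib (Suc (Suc r * (0 + 2))))"
  have *: "fib (Suc r * (0 + 2)) = fib (Suc (Suc r + r))"
    "fib (Suc (Suc r * (0 + 2))) = fib (Suc (Suc r + Suc r))"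
    by (auto simp: mult_2_right)
  have c: "((0::nat) + 2) choose 2 = 1" by (simp add: choose_two)
  have "X = 2 * f * g + f ^ 2" "Z = (f + g) ^ 2 + f ^ 2"
    unfolding * X_def Z_def fib_add by (simp_all add: f_def g_def algebra_simps power2_eq_square)
  then show ?case unfolding f_def[symmetric] g_def[symmetric] X_def[symmetric] Z_def[symmetric] c
    by (intro exI[of _ 0] exI[of _ 2]) (simp add: algebra_simps power2_eq_square)
next
  case (Suc j)
  define f g where "f = int (fib (Suc r))" and "g = int (fib r)"
  define c where "c = int ((j + 2) choose 2)"
  define X Z where "X = int (fib (Suc r * (j + 2)))" and "Z = int (fib (Suc (Suc r * (j + 2))))"
  from Suc.IH obtain t u where
    X: "X = int (j + 2) * f * g ^ (j + 1) + c * f ^ 2 * g ^ j + f ^ 3 * t" and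
    Z: "Z = g ^ (j + 2) + int (j + 2) * f * g ^ (j + 1) + f ^ 2 * u"
    unfolding f_def g_def X_def Z_def c_def by blast
  have *: "fib (Suc r * (Suc j + 2)) = fib (Suc (Suc r * (j + 2) + r))"
    "fib (Suc (Suc r * (Suc j + 2))) = fib (Suc (Suc r * (j + 2) + Suc r))"
    by (simp_all add: algebra_simps)
  have X': "int (fib (Suc r * (Suc j + 2))) = f * Z + g * X"
    unfolding * fib_add f_def g_def X_def Z_def by simp
  have Z': "int (fib (Suc (Suc r * (Suc j + 2)))) = (f + g) * Z + f * X"
    unfolding * fib_add f_def g_def X_def Z_def by (simp add: algebra_simps)
  have c': "int ((Suc j + 2) choose 2) = c + int (j + 2)"
    unfolding c_def by (simp add: numeral_2_eq_2)
  have "f * Z + g * X = int (Suc j + 2) * f * g ^ (Suc j + 1) + (c + int (j + 2)) * f ^ 2 * g ^ Suc j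
      + f ^ 3 * (u + g * t)"
    unfolding X Z by (simp add: algebra_simps power2_eq_square power3_eq_cube)
  moreover have "(f + g) * Z + f * X = g ^ (Suc j + 2) + int (Suc j + 2) * f * g ^ (Suc j + 1)
      + f ^ 2 * (2 * int (j + 2) * g ^ (j + 1) + (f + g) * u + f * c * g ^ j + f ^ 2 * t)"
    unfolding X Z by (simp add: algebra_simps power2_eq_square power3_eq_cube)
  ultimately show ?case unfolding X' Z' c' f_def[symmetric] g_def[symmetric] by blast
qed

text \<open>The number is the Lucas number of index r + 1, which is F (2 r + 2) / F (r + 1).
  \<open>S\<close> is the full cycle, of length 12, of pairs of consecutive Fibonacci residues
  modulo 8. The lemma bounds the 2-adic valuation when an index is doubled.\<close>

lemma not_8_dvd_lucas_fib: "\<not> 8 dvd (2 * fib r + fib (Suc r))"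
proof -
  define S :: "(nat \<times> nat) set" where
    "S = {(0,1),(1,1),(1,2),(2,3),(3,5),(5,0),(0,5),(5,5),(5,2),(2,7),(7,1),(1,0)}"
  have step: "(y, (y + x) mod 8) \<in> S" if "(x, y) \<in> S" for x y
    using that unfolding S_def by (elim insertE emptyE) simp_all
  have "(fib r mod 8, fib (Suc r) mod 8) \<in> S" for r
  proof (induction r)
    case (Suc r)
    have "fib (Suc (Suc r)) mod 8 = (fib (Suc r) mod 8 + fib r mod 8) mod 8"
      by (simp only: fib2 mod_add_eq)
    with step[OF Suc.IH] show ?case by (simp only:)
  qed (simp add: S_def)
  note residues = this[of r]
  have "(2 * fib r + fib (Suc r)) mod 8 = (2 * (fib r mod 8) + fib (Suc r) mod 8) mod 8"
    by (rule mod_add_cong) (simp_all add: mod_mult_right_eq)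
  also have "\<dots> \<noteq> 0" using residues unfolding S_def by (elim insertE emptyE) simp_all
  finally show ?thesis by (simp add: dvd_eq_mod_eq_0)
qed

lemma multiplicity_le_of_not_dvd:
  fixes p x :: nat assumes "\<not> p ^ Suc k dvd x" shows "multiplicity p x \<le> k"
  using assms by (metis multiplicity_dvd' not_less_eq_eq)

text \<open>The cofactor R = F (m q) / F m is q g^(j+1) + (q choose 2) f g^j + f^2 t, where p
  divides f but not g. If p and q differ, R is nonzero modulo p. If p = q is odd, R is p g^(j+1)
  modulo p^2. If p = q = 2, R is a Lucas number and not divisible by 8; this case is the origin of
  the factor 2, as F 3 = 2 and F 6 = 8 show.\<close>

lemma multiplicity_fib_mult_prime:
  assumes p: "prime p" and q: "prime q" and m: "m > 0" and pm: "p dvd fib m"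
  shows "multiplicity p (fib (m * q)) \<le> multiplicity p (fib m) + 2 * multiplicity p q"
proof -
  obtain r where r: "m = Suc r" using m by (cases m) auto
  obtain j where j: "q = j + 2" using prime_ge_2_nat[OF q] by (metis add.commute le_Suc_ex)
  define f g where "f = int (fib (Suc r))" and "g = int (fib r)"
  obtain t u where X: "int (fib (m * q)) = int q * f * g ^ (j + 1) + int (q choose 2) * f ^ 2 * g ^ j + f ^ 3 * t"
    using fib_mult_expansion[of r j] unfolding r j f_def g_def by blast
  obtain R where R: "fib (m * q) = fib m * R" using fib_dvd_fib[of m "m * q"] by (auto elim: dvdE)
  have fpos: "fib m > 0" "fib (m * q) > 0"
    using m q by (auto simp: fib_pos_iff prime_gt_0_nat)
  have "f * int R = int (fib (m * q))" unfolding R f_def r[symmetric] by simp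
  also have "\<dots> = f * (int q * g ^ (j + 1) + int (q choose 2) * f * g ^ j + f ^ 2 * t)"
    unfolding X by (simp add: algebra_simps power2_eq_square power3_eq_cube)
  finally have "f * int R = f * (int q * g ^ (j + 1) + int (q choose 2) * f * g ^ j + f ^ 2 * t)" .
  then have R': "int R = int q * g ^ (j + 1) + int (q choose 2) * f * g ^ j + f ^ 2 * t"
    using fpos by (simp add: f_def r)
  have pf: "int p dvd f" using pm by (simp add: f_def r)
  have "coprime (fib r) (fib (Suc r))" by (rule coprime_fib_Suc_nat)
  then have "\<not> p dvd fib r" using pm p unfolding r
    by (metis coprime_common_divisor not_prime_unit)
  then have pg: "\<not> int p dvd g ^ i" for i
    using p by (metis g_def int_dvd_int_iff prime_dvd_power prime_nat_int_transfer)
  have "multiplicity p R \<le> 2 * multiplicity p q"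
  proof (cases "p = q")
    case False
    have "\<not> int p dvd int R"
    proof
      assume "int p dvd int R"
      then have "int p dvd int R - f * (int (q choose 2) * g ^ j + f * t)"
        using pf by (intro dvd_diff dvd_mult2)
      also have "\<dots> = int q * g ^ (j + 1)" unfolding R' by (simp add: algebra_simps power2_eq_square)
      finally have "int p dvd int q"
        using p pg prime_dvd_multD by (metis prime_nat_int_transfer)
      then show False using False p q by (simp add: primes_dvd_imp_eq)
    qed
    then show ?thesis by (simp add: not_dvd_imp_multiplicity_0)
  next
    case [simp]: True
    have mp: "multiplicity p q = 1" using p by simp
    show ?thesis
    proof (cases "p = 2")
      case True
      have "fib m * R = fib (2 * m)" using R \<open>p = q\<close> True by (simp add: mult.commute)
      also have "\<dots> = (2 * fib r + fib (Suc r)) * fib m" by (subst fib_rec_even') (simp add: r)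
      finally have "R = 2 * fib r + fib (Suc r)" using fpos by (simp add: mult.commute)
      with not_8_dvd_lucas_fib[of r] have "\<not> p ^ Suc 2 dvd R" using True by simp
      from multiplicity_le_of_not_dvd[OF this] mp show ?thesis by simp
    next
      case False
      then have "odd p" using p by (metis prime_odd_nat prime_ge_2_nat le_neq_implies_less)
      then obtain h where "p = 2 * h + 1" by (rule oddE)
      then have h: "p - 1 = 2 * h" by simp
      \<comment> \<open>For odd p the binomial coefficient supplies a second factor p besides the
        one in f, so the middle term vanishes modulo p^2.\<close>
      have "q choose 2 = p * h" using h by (simp add: choose_two)
      have "\<not> int p ^ 2 dvd int R"
      proof
        assume "int p ^ 2 dvd int R"
        moreover from pf obtain f' where f': "f = int p * f'" by (elim dvdE)
        have R2: "int R - int p ^ 2 * (int h * f' * g ^ j + f' ^ 2 * t) = int p * g ^ (j + 1)"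
          unfolding R' \<open>q choose 2 = p * h\<close> f' by (simp add: algebra_simps power2_eq_square)
        ultimately have "int p ^ 2 dvd int p * g ^ (j + 1)"
          by (metis R2 dvd_diff dvd_triv_left)
        then have "int p dvd g ^ (j + 1)" using p by (simp add: power2_eq_square prime_gt_0_nat)
        then show False using pg by blast
      qed
      then have "\<not> p ^ Suc 1 dvd R"
        by (metis Suc_1 of_nat_dvd_iff of_nat_power)
      from multiplicity_le_of_not_dvd[OF this] mp show ?thesis by simp
    qed
  qed
  moreover have "multiplicity p (fib (m * q)) = multiplicity p (fib m) + multiplicity p R"
    unfolding R using fpos R p by (intro prime_elem_multiplicity_mult_distrib) auto
  ultimately show ?thesis by simp
qed

lemma multiplicity_fib_mult:
  assumes p: "prime p" and "m > 0" and "p dvd fib m" and "k > 0"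
  shows "multiplicity p (fib (m * k)) \<le> multiplicity p (fib m) + 2 * multiplicity p k"
  using assms(4)
proof (induction k rule: prime_divisors_induct)
  case (factor q k)
  then have k: "k > 0" by simp
  have "p dvd fib (m * k)" using assms(3) fib_dvd_fib[of m "m * k"] dvd_trans by auto
  then have "multiplicity p (fib (m * k * q)) \<le> multiplicity p (fib (m * k)) + 2 * multiplicity p q"
    using factor k assms by (intro multiplicity_fib_mult_prime) auto
  moreover have "multiplicity p (q * k) = multiplicity p q + multiplicity p k"
    using factor k p by (intro prime_elem_multiplicity_mult_distrib) auto
  ultimately show ?case using factor.IH k by (simp add: mult_ac)
qed auto

text \<open>Compare valuations at a prime p dividing F n. Its rank z divides n, say n = z k;
  \<open>fib_prim z\<close> contains the whole p-part of F z, and passing from z to z k adds at most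
  twice the valuation of k, which \<open>n ^ 2\<close> absorbs.\<close>

lemma fib_dvd_prod_fib_prim:
  assumes n: "n > 0"
  shows "fib n dvd n ^ 2 * (\<Prod>d | d dvd n. fib_prim d)"
proof (rule multiplicity_le_imp_dvd)
  show "fib n \<noteq> 0" using n by (simp add: fib_neq_0_nat)
next
  fix p :: nat assume p: "prime p"
  let ?P = "\<Prod>d | d dvd n. fib_prim d"
  have fin: "finite {d. d dvd n}" using n by simp
  have Ppos: "?P > 0" using fib_prim_pos by (intro prod_pos) auto
  show "multiplicity p (fib n) \<le> multiplicity p (n ^ 2 * ?P)"
  proof (cases "p dvd fib n")
    case False
    then show ?thesis by (simp add: not_dvd_imp_multiplicity_0)
  next
    case True
    define z where "z = (LEAST z. z > 0 \<and> p dvd fib z)"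
    have z: "z > 0" "p dvd fib z"
      using LeastI[of "\<lambda>z. z > 0 \<and> p dvd fib z" n] n True unfolding z_def by auto
    have zmin: "\<not> p dvd fib e" if "0 < e" "e < z" for e
      using not_less_Least[of e "\<lambda>z. z > 0 \<and> p dvd fib z"] that unfolding z_def by auto
    have "p dvd fib (gcd z n)" using z True by (simp add: fib_gcd)
    moreover have "gcd z n > 0" "gcd z n \<le> z" using z by (auto intro: dvd_imp_le)
    ultimately have "gcd z n = z" using zmin by (metis le_neq_implies_less)
    then have "z dvd n" by (metis gcd_dvd2)
    then obtain k where k: "n = z * k" by (elim dvdE)
    have "k > 0" using n k by auto
    have "multiplicity p (fib z) = multiplicity p (fib_prim z)"
    proof -
      let ?S = "{p \<in> prime_factors (fib z). \<forall>e. 0 < e \<and> e < z \<longrightarrow> \<not> p dvd fib e}"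
      have "p \<in> ?S"
        using z zmin p by (auto simp: in_prime_factors_iff fib_neq_0_nat)
      then show ?thesis unfolding fib_prim_def
        by (subst multiplicity_prod_prime_powers) (use p in auto)
    qed
    also have "\<dots> \<le> multiplicity p ?P"
      using \<open>z dvd n\<close> fin Ppos by (intro dvd_imp_multiplicity_le) (auto simp del: prod_pos)
    finally have "multiplicity p (fib z) \<le> multiplicity p ?P" .
    moreover have "multiplicity p k \<le> multiplicity p n"
      using n k by (intro dvd_imp_multiplicity_le) auto
    moreover have "multiplicity p (fib n) \<le> multiplicity p (fib z) + 2 * multiplicity p k"
      unfolding k using p z \<open>k > 0\<close> by (intro multiplicity_fib_mult)
    moreover have "multiplicity p (n ^ 2 * ?P) = 2 * multiplicity p n + multiplicity p ?P"
      using n Ppos p by (subst prime_elem_multiplicity_mult_distrib) 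
        (auto simp: prime_elem_multiplicity_power_distrib)
    ultimately show ?thesis by simp
  qed
qed

lemma prod_fib_prim_dvd:
  assumes "finite A" "0 \<notin> A" "\<And>d. d \<in> A \<Longrightarrow> fib_prim d dvd x"
  shows "(\<Prod>d\<in>A. fib_prim d) dvd x"
  using assms
proof (induction A rule: finite_induct)
  case (insert d A)
  have "coprime (fib_prim d) (\<Prod>d\<in>A. fib_prim d)"
    using insert by (intro prod_coprime_right coprime_fib_prim) (auto intro!: Nat.gr0I)
  then show ?case using insert by (auto intro: divides_mult)
qed auto

section \<open>Logarithms of the primitive parts\<close>

definition ln_fib_prim :: "nat \<Rightarrow> real" where
  "ln_fib_prim d = ln (real (fib_prim d))"

lemma ln_fib_prim_nonneg: "ln_fib_prim d \<ge> 0"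
  using fib_prim_pos[of d] unfolding ln_fib_prim_def by (intro ln_ge_zero) linarith

lemma ln_prod_fib_prim: "finite A \<Longrightarrow> ln (real (\<Prod>d\<in>A. fib_prim d)) = (\<Sum>d\<in>A. ln_fib_prim d)"
  using fib_prim_pos unfolding ln_fib_prim_def of_nat_prod by (subst ln_prod) (auto simp: less_imp_neq)

lemma sum_ln_fib_prim_le:
  assumes "n > 0"
  shows "(\<Sum>d | d dvd n. ln_fib_prim d) \<le> ln (real (fib n))"
proof -
  have "(\<Prod>d | d dvd n. fib_prim d) dvd fib n"
    using assms by (intro prod_fib_prim_dvd) (auto intro: dvd_trans[OF fib_prim_dvd_fib] fib_dvd_fib)
  then have "(\<Prod>d | d dvd n. fib_prim d) \<le> fib n"
    using assms by (intro dvd_imp_le) (auto simp: fib_pos_iff)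
  moreover have "(\<Prod>d | d dvd n. fib_prim d) > 0" using fib_prim_pos by (intro prod_pos) auto
  ultimately have "ln (real (\<Prod>d | d dvd n. fib_prim d)) \<le> ln (real (fib n))"
    using assms by (subst ln_le_cancel_iff) (simp_all only: fib_pos_iff of_nat_0_less_iff of_nat_le_iff)
  then show ?thesis using assms by (simp only: ln_prod_fib_prim finite_divisors_nat)
qed

lemma ln_fib_le_sum:
  assumes "n > 0"
  shows "ln (real (fib n)) \<le> 2 * ln (real n) + (\<Sum>d | d dvd n. ln_fib_prim d)"
proof -
  let ?P = "\<Prod>d | d dvd n. fib_prim d"
  have P: "?P > 0" using fib_prim_pos by (intro prod_pos) auto
  have "fib n \<le> n ^ 2 * ?P"
    using assms P fib_dvd_prod_fib_prim[of n] by (intro dvd_imp_le) auto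
  then have "real (fib n) \<le> real n ^ 2 * real ?P"
    by (metis of_nat_le_iff of_nat_mult of_nat_power)
  then have "ln (real (fib n)) \<le> ln (real n ^ 2 * real ?P)"
    using assms P by (subst ln_le_cancel_iff) (simp_all only: fib_pos_iff of_nat_0_less_iff
      zero_less_power zero_less_mult_iff simp_thms)
  also have "\<dots> = ln (real n ^ 2) + ln (real ?P)"
    using assms P by (intro ln_mult_pos) (simp_all only: of_nat_0_less_iff zero_less_power)
  also have "ln (real n ^ 2) = 2 * ln (real n)"
    using assms by (simp add: ln_realpow)
  also have "ln (real ?P) = (\<Sum>d | d dvd n. ln_fib_prim d)"
    using assms by (simp only: ln_prod_fib_prim finite_divisors_nat)
  finally show ?thesis .
qed

section \<open>Factorisation of shifted Lucas numbers\<close>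

lemma golden_ratio_gt_1: "golden_ratio > 1"
  by (simp add: golden_ratio_def)

lemma golden_ratio_square: "golden_ratio ^ 2 = golden_ratio + 1"
  by (simp add: golden_ratio_def power2_eq_square field_simps)

lemma golden_ratio_mult_conjugate: "golden_ratio * (1 - golden_ratio) = - 1"
  using golden_ratio_square by (simp add: algebra_simps power2_eq_square)

lemma golden_conjugate_square: "(1 - golden_ratio) ^ 2 = (1 - golden_ratio) + 1"
  using golden_ratio_square by (simp add: algebra_simps power2_eq_square)

lemma lucas_closed_form: "real_of_int (lucas n) = golden_ratio ^ n + (1 - golden_ratio) ^ n"
proof (induction n rule: lucas.induct)
  case (3 n)
  have "golden_ratio ^ Suc (Suc n) = golden_ratio ^ n * golden_ratio ^ 2"
    "(1 - golden_ratio) ^ Suc (Suc n) = (1 - golden_ratio) ^ n * (1 - golden_ratio) ^ 2"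
    by (simp_all add: power2_eq_square mult_ac)
  then show ?case using 3
    unfolding golden_ratio_square golden_conjugate_square by (simp add: algebra_simps)
qed auto

lemma fib_golden_ratio: "sqrt 5 * real (fib n) = golden_ratio ^ n - (1 - golden_ratio) ^ n"
proof -
  have "1 - golden_ratio = (1 - sqrt 5) / 2" by (simp add: golden_ratio_def field_simps)
  then show ?thesis using fib_closed_form[of n] unfolding golden_ratio_def[symmetric]
    by (simp only:) simp
qed

section \<open>Product identities for Lucas numbers shifted by a sign\<close>

context
  fixes m :: nat and A B :: real
  defines "A \<equiv> golden_ratio ^ m" and "B \<equiv> (1 - golden_ratio) ^ m"
begin

private lemma AB: "A * B = (-1) ^ m"
  unfolding A_def B_def power_mult_distrib[symmetric] golden_ratio_mult_conjugate ..

private lemma pow: "golden_ratio ^ (k * m) = A ^ k" "(1 - golden_ratio) ^ (k * m) = B ^ k"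
  unfolding A_def B_def by (simp_all add: power_mult[symmetric] mult.commute)

lemma lucas_mult_fib: "lucas m * int (fib m) = int (fib (2 * m))"
proof -
  have "sqrt 5 * (real_of_int (lucas m) * real (fib m)) = (A + B) * (A - B)"
    using fib_golden_ratio[of m] lucas_closed_form[of m]
    unfolding A_def[symmetric] B_def[symmetric] by (simp add: mult.left_commute)
  also have "\<dots> = sqrt 5 * real (fib (2 * m))"
    unfolding fib_golden_ratio pow by (simp add: algebra_simps power2_eq_square)
  finally have "real_of_int (lucas m * int (fib m)) = real_of_int (int (fib (2 * m)))" by simp
  then show ?thesis unfolding of_int_eq_iff .
qed

text \<open>The sign is A B, so the shifted number is A^2 + A B + B^2 = (A^3 - B^3) / (A - B). With
  the opposite sign, A^2 - A B + B^2 = (A^3 + B^3) / (A + B) gives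
  \<open>lucas_double_minus\<close>.\<close>

lemma lucas_double_plus: "(lucas (2 * m) + (-1) ^ m) * int (fib m) = int (fib (3 * m))"
proof -
  have "sqrt 5 * ((real_of_int (lucas (2 * m)) + (-1) ^ m) * real (fib m)) = (A ^ 2 + B ^ 2 + A * B) * (A - B)"
    using fib_golden_ratio[of m] unfolding lucas_closed_form pow AB
    unfolding A_def[symmetric] B_def[symmetric] by (simp add: mult.left_commute)
  also have "\<dots> = sqrt 5 * real (fib (3 * m))"
    unfolding fib_golden_ratio pow by (simp add: algebra_simps power2_eq_square power3_eq_cube)
  finally have "real_of_int ((lucas (2 * m) + (-1) ^ m) * int (fib m)) = real_of_int (int (fib (3 * m)))"
    by simp
  then show ?thesis unfolding of_int_eq_iff .
qed

lemma lucas_double_minus: "(lucas (2 * m) - (-1) ^ m) * lucas m = lucas (3 * m)"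
proof -
  have "(real_of_int (lucas (2 * m)) - (-1) ^ m) * real_of_int (lucas m) = (A ^ 2 + B ^ 2 - A * B) * (A + B)"
    unfolding lucas_closed_form pow AB unfolding A_def[symmetric] B_def[symmetric] ..
  also have "\<dots> = real_of_int (lucas (3 * m))"
    unfolding lucas_closed_form pow by (simp add: algebra_simps power2_eq_square power3_eq_cube)
  finally have "real_of_int ((lucas (2 * m) - (-1) ^ m) * lucas m) = real_of_int (lucas (3 * m))"
    by simp
  then show ?thesis unfolding of_int_eq_iff .
qed

text \<open>Since \<alpha> and its conjugate have sum 1, the mixed terms of (A + B) (A \<alpha> + B
  (1 - \<alpha>)) add up to A B, which is the sign. Two minus signs instead give
  \<open>lucas_odd_minus\<close>, where each factor carries a \<open>sqrt 5\<close>.\<close>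

lemma lucas_odd_plus: "lucas (2 * m + 1) + (-1) ^ m = lucas m * lucas (m + 1)"
proof -
  have "real_of_int (lucas (2 * m + 1)) + (-1) ^ m
      = A ^ 2 * golden_ratio + B ^ 2 * (1 - golden_ratio) + A * B"
    unfolding lucas_closed_form power_add pow AB by simp
  also have "\<dots> = (A + B) * (A * golden_ratio + B * (1 - golden_ratio))"
    by (simp add: algebra_simps power2_eq_square)
  also have "\<dots> = real_of_int (lucas m) * real_of_int (lucas (m + 1))"
    unfolding lucas_closed_form power_add A_def B_def by simp
  finally have "real_of_int (lucas (2 * m + 1) + (-1) ^ m) = real_of_int (lucas m * lucas (m + 1))"
    by simp
  then show ?thesis unfolding of_int_eq_iff .
qed

lemma lucas_odd_minus: "lucas (2 * m + 1) - (-1) ^ m = 5 * int (fib m) * int (fib (m + 1))"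
proof -
  have "real_of_int (lucas (2 * m + 1)) - (-1) ^ m
      = A ^ 2 * golden_ratio + B ^ 2 * (1 - golden_ratio) - A * B"
    unfolding lucas_closed_form power_add pow AB by simp
  also have "\<dots> = (A - B) * (A * golden_ratio - B * (1 - golden_ratio))"
    by (simp add: algebra_simps power2_eq_square)
  also have "\<dots> = (sqrt 5 * real (fib m)) * (sqrt 5 * real (fib (m + 1)))"
    unfolding fib_golden_ratio power_add A_def B_def by simp
  also have "\<dots> = (sqrt 5 * sqrt 5) * (real (fib m) * real (fib (m + 1)))"
    by (simp only: mult_ac)
  finally have "real_of_int (lucas (2 * m + 1) - (-1) ^ m) = real_of_int (5 * int (fib m) * int (fib (m + 1)))"
    by simp
  then show ?thesis unfolding of_int_eq_iff .
qed

end

text \<open>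
  The indices \<open>d\<close> for which \<open>fib_prim d\<close> divides \<open>lucas n + s\<close>, read off from the factorisations
  above; the conditions \<open>\<not> d dvd _\<close> come from the Fibonacci numbers in the denominators.
  For \<open>n = 1\<close> and \<open>s = -1\<close>, where \<open>lucas n + s = 0\<close>, this is the set of all natural numbers.
\<close>
definition shifted_lucas_cover :: "nat \<Rightarrow> int \<Rightarrow> nat set" where
  "shifted_lucas_cover n s = (let m = n div 2 in
     if even n then
       if s = (-1) ^ m then {d. d dvd 3 * m \<and> \<not> d dvd m}
       else {d. d dvd 6 * m \<and> \<not> d dvd 3 * m \<and> \<not> d dvd 2 * m}
     else
       if s = (-1) ^ m then {d. d dvd 2 * m \<and> \<not> d dvd m} \<union> {d. d dvd 2 * (m + 1) \<and> \<not> d dvd m + 1}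
       else {d. d dvd m} \<union> {d. d dvd m + 1})"

abbreviation sum_ln_fib_prim :: "nat \<Rightarrow> real" where
  "sum_ln_fib_prim n \<equiv> \<Sum>d | d dvd n. ln_fib_prim d"

lemma fib_prim_dvd_fib_mult: "d dvd n \<Longrightarrow> fib_prim d dvd fib n"
  using dvd_trans[OF fib_prim_dvd_fib fib_dvd_fib] .

lemma ln_fib_prim_1: "ln_fib_prim (Suc 0) = 0"
  by (simp add: ln_fib_prim_def fib_prim_def)

lemma ln_fib_prim_2: "ln_fib_prim 2 = 0"
  by (simp add: ln_fib_prim_def fib_prim_def)

lemma sum_dvd_diff:
  fixes f :: "nat \<Rightarrow> real"
  assumes "n > 0" "m dvd n"
  shows "(\<Sum>d | d dvd n \<and> \<not> d dvd m. f d) = (\<Sum>d | d dvd n. f d) - (\<Sum>d | d dvd m. f d)"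
proof -
  have "{d. d dvd n \<and> \<not> d dvd m} = {d. d dvd n} - {d. d dvd m}" by auto
  moreover have "{d. d dvd m} \<subseteq> {d. d dvd n}" using assms by (auto intro: dvd_trans)
  ultimately show ?thesis using assms by (simp add: sum_diff)
qed

lemma lucas_nat:
  assumes "m > 0"
  obtains l where "lucas m = int l" "l > 0" "l * fib m = fib (2 * m)"
proof -
  have "lucas m * int (fib m) > 0" using assms by (simp add: lucas_mult_fib fib_pos_iff)
  then have "lucas m > 0" by (simp add: zero_less_mult_iff)
  then have l: "lucas m = int (nat (lucas m))" by simp
  have "int (nat (lucas m) * fib m) = int (fib (2 * m))"
    using l lucas_mult_fib[of m] by simp
  then show ?thesis using that[of "nat (lucas m)"] l \<open>lucas m > 0\<close> by (simp only: of_nat_eq_iff zero_less_nat_eq)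
qed

text \<open>In F (2 m) / F m the numerator is estimated from above by \<open>ln_fib_le_sum\<close>
  and the denominator from below by \<open>sum_ln_fib_prim_le\<close>.\<close>

lemma ln_lucas_le:
  assumes "m > 0" "l * fib m = fib (2 * m)"
  shows "ln (real l) \<le> (\<Sum>d | d dvd 2 * m \<and> \<not> d dvd m. ln_fib_prim d) + 2 * ln (real (2 * m))"
proof -
  have "l > 0" using assms fib_pos_iff[of "2 * m"] by (metis mult_eq_0_iff neq0_conv nat_0_less_mult_iff zero_less_numeral)
  then have "ln (real (fib (2 * m))) = ln (real l) + ln (real (fib m))"
    using assms by (simp add: ln_mult_pos fib_pos_iff flip: assms(2))
  then show ?thesis
    using sum_ln_fib_prim_le[of m] ln_fib_le_sum[of "2 * m"] assms by (subst sum_dvd_diff) auto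
qed

lemma fib_prim_dvd_lucas:
  assumes "m > 0" "l * fib m = fib (2 * m)" "d dvd 2 * m" "\<not> d dvd m"
  shows "fib_prim d dvd l"
proof -
  have "fib_prim d dvd l * fib m" using assms fib_prim_dvd_fib_mult by simp
  moreover have "coprime (fib_prim d) (fib m)"
    using assms by (intro coprime_fib_prim_fib) (auto intro!: Nat.gr0I)
  ultimately show ?thesis by (simp add: coprime_dvd_mult_left_iff)
qed

text \<open>A primitive part indexed by the cover divides the Fibonacci numerator and is coprime to
  the denominators. For the logarithm, numerators are bounded from above at a cost of two logarithms
  each, denominators from below at no cost. All indices that occur are at most 3 n, with equality
  for 6 m when n is even. The largest total cost is five logarithms, for 5 F m F (m + 1); 8 is a
  common bound.\<close>

lemma shifted_lucas_factor:
  assumes n: "n \<ge> 2" and s: "s \<in> {-1, 1}"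
  shows "\<exists>t. lucas n + s = int t \<and> t > 0 \<and> (\<Prod>d\<in>shifted_lucas_cover n s. fib_prim d) dvd t
    \<and> ln (real t) \<le> (\<Sum>d\<in>shifted_lucas_cover n s. ln_fib_prim d) + 8 * ln (real (3 * n))"
proof -
  define m where "m = n div 2"
  have m: "m > 0" using n by (auto simp: m_def)
  define u :: int where "u = (-1) ^ m"
  have su: "s = u \<or> s = - u" and u0: "u \<noteq> - u" using s unfolding u_def by (cases "even m"; auto)+
  define L where "L = ln (real (3 * n))"
  have lnmono: "ln (real a) \<le> L" if "a > 0" "a \<le> 3 * n" for a
    using that by (simp add: L_def)
  have ln0: "0 \<le> L" unfolding L_def using n by (intro ln_ge_zero) auto
  have upper: "ln (real (fib k)) \<le> 2 * L + sum_ln_fib_prim k" if "k > 0" "k \<le> 3 * n" for k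
    using ln_fib_le_sum[OF that(1)] lnmono[OF that] by linarith
  have mn: "2 * m \<le> n" "n \<le> 2 * m + 1" by (auto simp: m_def)
  show ?thesis
  proof (cases "even n")
    case True
    then have n2: "n = 2 * m" by (auto simp: m_def)
    show ?thesis
    proof (cases "s = u")
      case True
      have cov: "shifted_lucas_cover n s = {d. d dvd 3 * m \<and> \<not> d dvd m}"
        using \<open>even n\<close> True by (simp add: shifted_lucas_cover_def m_def[symmetric] u_def[symmetric])
      have eq: "(lucas n + s) * int (fib m) = int (fib (3 * m))"
        using lucas_double_plus[of m] True by (simp add: n2 u_def)
      have "(lucas n + s) * int (fib m) > 0" unfolding eq using m by (simp add: fib_pos_iff)
      then have "lucas n + s > 0" by (simp add: zero_less_mult_iff)
      then obtain t where t: "lucas n + s = int t" "t > 0" by (metis zero_less_imp_eq_int)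
      have tf: "t * fib m = fib (3 * m)" using eq t by (simp flip: of_nat_mult)
      have "(\<Prod>d\<in>shifted_lucas_cover n s. fib_prim d) dvd t"
      proof (rule prod_fib_prim_dvd)
        fix d assume d: "d \<in> shifted_lucas_cover n s"
        then have "fib_prim d dvd t * fib m" unfolding tf cov by (auto intro: fib_prim_dvd_fib_mult)
        moreover have "coprime (fib_prim d) (fib m)"
          using d m unfolding cov by (intro coprime_fib_prim_fib) (auto intro!: Nat.gr0I)
        ultimately show "fib_prim d dvd t" by (simp add: coprime_dvd_mult_left_iff)
      qed (use m in \<open>auto simp: cov\<close>)
      moreover have "ln (real t) \<le> (\<Sum>d\<in>shifted_lucas_cover n s. ln_fib_prim d) + 8 * L"
      proof -
        have pos: "3 * m > 0" "3 * m \<le> 3 * n" using m mn by auto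
        have "ln (real (fib (3 * m))) = ln (real t) + ln (real (fib m))"
          using m t by (simp add: ln_mult_pos fib_pos_iff flip: tf)
        moreover have "(\<Sum>d\<in>shifted_lucas_cover n s. ln_fib_prim d)
            = sum_ln_fib_prim (3 * m) - sum_ln_fib_prim m"
          unfolding cov using m by (intro sum_dvd_diff) auto
        ultimately show ?thesis
          using sum_ln_fib_prim_le[OF m] upper[of "3 * m", OF pos] ln0 by linarith
      qed
      ultimately show ?thesis using t unfolding L_def[symmetric] by (intro exI[of _ t] conjI)
    next
      case False
      then have s: "s = - u" using su by simp
      have cov: "shifted_lucas_cover n s = {d. d dvd 6 * m \<and> \<not> d dvd 3 * m \<and> \<not> d dvd 2 * m}"
        using \<open>even n\<close> False by (simp add: shifted_lucas_cover_def m_def[symmetric] u_def[symmetric])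
      obtain l where l: "lucas m = int l" "l > 0" "l * fib m = fib (2 * m)"
        using lucas_nat[OF m] .
      obtain k where k: "lucas (3 * m) = int k" "k > 0" "k * fib (3 * m) = fib (2 * (3 * m))"
        using lucas_nat[of "3 * m"] m by auto
      have eq: "(lucas n + s) * int l = int k"
        using lucas_double_minus[of m] s unfolding n2 u_def l k by simp
      then have "lucas n + s > 0" using l k by (metis of_nat_0_less_iff zero_less_mult_pos2)
      then obtain t where t: "lucas n + s = int t" "t > 0" by (metis zero_less_imp_eq_int)
      have tl: "t * l = k" using eq t by (simp flip: of_nat_mult)
      have "fib (6 * m) = k * fib (3 * m)" using k(3) by simp
      \<comment> \<open>The shifted number is L (3 m) / L m; writing both Lucas numbers as Fibonacci
        quotients gives F (6 m) F m / (F (2 m) F (3 m)).\<close>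
      then have tf: "t * (fib (2 * m) * fib (3 * m)) = fib (6 * m) * fib m"
        unfolding l(3)[symmetric] tl[symmetric] by (simp only: mult_ac)
      have "(\<Prod>d\<in>shifted_lucas_cover n s. fib_prim d) dvd t"
      proof (rule prod_fib_prim_dvd)
        fix d assume d: "d \<in> shifted_lucas_cover n s"
        then have "fib_prim d dvd t * (fib (2 * m) * fib (3 * m))"
          unfolding tf cov by (auto intro: dvd_mult2 fib_prim_dvd_fib_mult)
        moreover have "d > 0" using d m unfolding cov by (auto intro!: Nat.gr0I)
        then have "coprime (fib_prim d) (fib (2 * m) * fib (3 * m))"
          using d coprime_fib_prim_fib unfolding cov by auto
        ultimately show "fib_prim d dvd t" by (simp add: coprime_dvd_mult_left_iff)
      qed (use m in \<open>auto simp: cov\<close>)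
      moreover have "ln (real t) \<le> (\<Sum>d\<in>shifted_lucas_cover n s. ln_fib_prim d) + 8 * L"
      proof -
        have pos: "2 * m > 0" "3 * m > 0" "6 * m > 0" "6 * m \<le> 3 * n" "m > 0" "m \<le> 3 * n"
          using m mn by auto
        have "ln (real (t * (fib (2 * m) * fib (3 * m)))) = ln (real (fib (6 * m) * fib m))"
          unfolding tf ..
        then have "ln (real t) + ln (real (fib (2 * m))) + ln (real (fib (3 * m)))
            = ln (real (fib (6 * m))) + ln (real (fib m))"
          using m t by (simp add: ln_mult_pos fib_pos_iff)
        moreover have "(\<Sum>d\<in>shifted_lucas_cover n s. ln_fib_prim d)
            = sum_ln_fib_prim (6 * m) - sum_ln_fib_prim (3 * m) - sum_ln_fib_prim (2 * m) + sum_ln_fib_prim m"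
        proof -
          \<comment> \<open>Inclusion and exclusion: a common divisor of 2 m and 3 m divides m, so
            the cover is a difference of two nested sets whose sums match the Fibonacci
            quotient.\<close>
          have "shifted_lucas_cover n s =
              {d. d dvd 6 * m \<and> \<not> d dvd 3 * m} - {d. d dvd 2 * m \<and> \<not> d dvd m}"
          proof -
            have "d dvd m" if "d dvd 2 * m" "d dvd 3 * m" for d
              using dvd_diff_nat[OF that(2) that(1)] by simp
            moreover have "d dvd 3 * m" if "d dvd m" for d using that by simp
            ultimately show ?thesis unfolding cov by blast
          qed
          moreover have "{d. d dvd 2 * m \<and> \<not> d dvd m} \<subseteq> {d. d dvd 6 * m \<and> \<not> d dvd 3 * m}"
          proof -
            have "d dvd 6 * m" if "d dvd 2 * m" for d using dvd_mult[OF that, of 3] by simp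
            moreover have "d dvd m" if "d dvd 2 * m" "d dvd 3 * m" for d
              using dvd_diff_nat[OF that(2) that(1)] by simp
            ultimately show ?thesis by blast
          qed
          ultimately have "(\<Sum>d\<in>shifted_lucas_cover n s. ln_fib_prim d)
              = (\<Sum>d | d dvd 6 * m \<and> \<not> d dvd 3 * m. ln_fib_prim d)
                - (\<Sum>d | d dvd 2 * m \<and> \<not> d dvd m. ln_fib_prim d)"
            using m by (simp add: sum_diff)
          moreover have "3 * m dvd 6 * m" using dvd_triv_right[of "3 * m" 2] by simp
          ultimately show ?thesis using m by (simp add: sum_dvd_diff)
        qed
        ultimately show ?thesis
          using sum_ln_fib_prim_le[OF pos(1)] sum_ln_fib_prim_le[OF pos(2)]
            upper[OF pos(3,4)] upper[OF pos(5,6)] ln0 by linarith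
      qed
      ultimately show ?thesis using t unfolding L_def[symmetric] by (intro exI[of _ t] conjI)
    qed
  next
    case odd: False
    then have n2: "n = 2 * m + 1" by (auto simp: m_def)
    show ?thesis
    proof (cases "s = u")
      case True
      have cov: "shifted_lucas_cover n s =
          {d. d dvd 2 * m \<and> \<not> d dvd m} \<union> {d. d dvd 2 * (m + 1) \<and> \<not> d dvd m + 1}"
        using odd True by (simp add: shifted_lucas_cover_def m_def[symmetric] u_def[symmetric])
      obtain l where l: "lucas m = int l" "l > 0" "l * fib m = fib (2 * m)"
        using lucas_nat[OF m] .
      obtain k where k: "lucas (m + 1) = int k" "k > 0" "k * fib (m + 1) = fib (2 * (m + 1))"
        using lucas_nat[of "m + 1"] by auto
      have t: "lucas n + s = int (l * k)"
        using lucas_odd_plus[of m] True unfolding n2 u_def l k by simp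
      have disj: "{d. d dvd 2 * m \<and> \<not> d dvd m} \<inter> {d. d dvd 2 * (m + 1) \<and> \<not> d dvd m + 1} = {}"
      proof -
        have False if d: "d dvd 2 * m" "\<not> d dvd m" "d dvd 2 * (m + 1)" "\<not> d dvd m + 1" for d
        proof -
          \<comment> \<open>A common element divides 2 (m + 1) - 2 m; but 1 divides m, and 2 divides
            one of m and m + 1.\<close>
          have "d dvd 2" using dvd_diff_nat[OF d(3) d(1)] by simp
          then have "d \<le> 2" "d > 0" by (auto intro: dvd_imp_le Nat.gr0I)
          then have "d = 1 \<or> d = 2" by linarith
          then show False using d(2,4) by (elim disjE) simp_all
        qed
        then show ?thesis by blast
      qed
      have "(\<Prod>d\<in>shifted_lucas_cover n s. fib_prim d) dvd l * k"
      proof (rule prod_fib_prim_dvd)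
        fix d assume d: "d \<in> shifted_lucas_cover n s"
        then have "fib_prim d dvd l \<or> fib_prim d dvd k"
          using fib_prim_dvd_lucas[OF _ l(3), of d] fib_prim_dvd_lucas[OF _ k(3), of d] m
          unfolding cov by auto
        then show "fib_prim d dvd l * k" by auto
      qed (use m in \<open>auto simp: cov\<close>)
      moreover have "ln (real (l * k)) \<le> (\<Sum>d\<in>shifted_lucas_cover n s. ln_fib_prim d) + 8 * L"
      proof -
        have pos: "m > 0" "m + 1 > 0" "2 * m > 0" "2 * m \<le> 3 * n" "2 * (m + 1) > 0" "2 * (m + 1) \<le> 3 * n"
          using m mn by auto
        have "ln (real (l * k)) = ln (real l) + ln (real k)" using l k by (simp add: ln_mult_pos)
        moreover have "(\<Sum>d\<in>shifted_lucas_cover n s. ln_fib_prim d)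
            = (\<Sum>d | d dvd 2 * m \<and> \<not> d dvd m. ln_fib_prim d)
              + (\<Sum>d | d dvd 2 * (m + 1) \<and> \<not> d dvd m + 1. ln_fib_prim d)"
          unfolding cov using m disj by (intro sum.union_disjoint) auto
        ultimately show ?thesis
          using ln_lucas_le[OF pos(1) l(3)] ln_lucas_le[OF pos(2) k(3)] lnmono[OF pos(3,4)] lnmono[OF pos(5,6)]
            ln0 by linarith
      qed
      ultimately show ?thesis using t l k unfolding L_def[symmetric] by (intro exI[of _ "l * k"] conjI) simp_all
    next
      case False
      then have s: "s = - u" using su by simp
      have cov: "shifted_lucas_cover n s = {d. d dvd m} \<union> {d. d dvd m + 1}"
        using odd False by (simp add: shifted_lucas_cover_def m_def[symmetric] u_def[symmetric])
      define t where "t = 5 * fib m * fib (m + 1)"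
      have t: "lucas n + s = int t"
        using lucas_odd_minus[of m] s unfolding n2 u_def t_def by simp
      have "(\<Prod>d\<in>shifted_lucas_cover n s. fib_prim d) dvd t"
      proof (rule prod_fib_prim_dvd)
        fix d assume d: "d \<in> shifted_lucas_cover n s"
        then have "fib_prim d dvd fib m \<or> fib_prim d dvd fib (m + 1)"
          unfolding cov using fib_prim_dvd_fib_mult by blast
        then show "fib_prim d dvd t" unfolding t_def by auto
      qed (use m in \<open>auto simp: cov\<close>)
      moreover have "ln (real t) \<le> (\<Sum>d\<in>shifted_lucas_cover n s. ln_fib_prim d) + 8 * L"
      proof -
        have pos: "m > 0" "m \<le> 3 * n" "m + 1 > 0" "m + 1 \<le> 3 * n" using m mn by auto
        have "ln (real t) = ln 5 + ln (real (fib m)) + ln (real (fib (m + 1)))"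
          using m fib_pos_iff[of "m + 1"] unfolding t_def by (simp add: ln_mult_pos fib_pos_iff)
        moreover have "(\<Sum>d\<in>shifted_lucas_cover n s. ln_fib_prim d) =
            sum_ln_fib_prim m + sum_ln_fib_prim (m + 1)"
        proof -
          \<comment> \<open>The two divisor sets meet only in 1, whose term is 0 because F 1 =
            1.\<close>
          have "ln_fib_prim d = 0" if "d dvd m" "d dvd m + 1" for d
            using dvd_diff_nat[OF that(2) that(1)] by (simp add: ln_fib_prim_1)
          then have "(\<Sum>d\<in>{d. d dvd m} \<inter> {d. d dvd m + 1}. ln_fib_prim d) = 0"
            by (intro sum.neutral) blast
          then show ?thesis unfolding cov using m by (subst sum_Un) auto
        qed
        moreover have "ln (5::real) \<le> L" using lnmono[of 5] n by simp
        ultimately show ?thesis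
          using upper[OF pos(1,2)] upper[OF pos(3,4)] ln0 by linarith
      qed
      ultimately show ?thesis using t m unfolding L_def[symmetric] by (intro exI[of _ t] conjI) (simp_all add: t_def fib_pos_iff)
    qed
  qed
qed

section \<open>The least common multiple for fixed signs\<close>

lemma shifted_lucas_cover_finite:
  assumes "n \<ge> 2"
  shows "finite (shifted_lucas_cover n s)" "shifted_lucas_cover n s \<subseteq> {1..3 * n}"
proof -
  define m where "m = n div 2"
  have m: "m > 0" "2 * m \<le> n" using assms by (auto simp: m_def)
  have *: "d \<in> {1..3 * n}" if "d dvd k" "k > 0" "k \<le> 3 * n" for d k
    using dvd_imp_le[OF that(1,2)] dvd_pos_nat[OF that(2,1)] that(3) by auto
  have pos: "3 * m > 0" "3 * m \<le> 3 * n" "6 * m > 0" "6 * m \<le> 3 * n" "2 * m > 0" "2 * m \<le> 3 * n"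
    "2 * (m + 1) > 0" "2 * (m + 1) \<le> 3 * n" "m \<le> 3 * n" "m + 1 > 0" "m + 1 \<le> 3 * n"
    using m assms by auto
  show "shifted_lucas_cover n s \<subseteq> {1..3 * n}"
    unfolding shifted_lucas_cover_def Let_def m_def[symmetric]
    using *[OF _ pos(1,2)] *[OF _ pos(3,4)] *[OF _ pos(5,6)] *[OF _ pos(7,8)] *[OF _ m(1) pos(9)]
      *[OF _ pos(10,11)]
    by (split if_split)+ blast
  then show "finite (shifted_lucas_cover n s)" by (rule finite_subset) simp
qed

text \<open>The recursive form lets positivity and measurability be proved by induction on
  n.\<close>

lemma shifted_lucas_lcm_Suc:
  "shifted_lucas_lcm t (Suc n) = (if lucas (Suc n) + t (Suc n) = 0 then shifted_lucas_lcm t n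
     else lcm (lucas (Suc n) + t (Suc n)) (shifted_lucas_lcm t n))"
proof -
  have "(\<lambda>k. lucas k + t k) ` {1..Suc n} - {0} =
      (if lucas (Suc n) + t (Suc n) = 0 then (\<lambda>k. lucas k + t k) ` {1..n} - {0}
       else insert (lucas (Suc n) + t (Suc n)) ((\<lambda>k. lucas k + t k) ` {1..n} - {0}))"
    by (auto simp: atLeastAtMostSuc_conv simp del: lucas.simps)
  then show ?thesis by (simp add: shifted_lucas_lcm_def del: lucas.simps)
qed

lemma shifted_lucas_lcm_pos: "shifted_lucas_lcm t n > 0"
proof (induction n)
  case 0
  then show ?case by (simp add: shifted_lucas_lcm_def)
next
  case (Suc n)
  then show ?case unfolding shifted_lucas_lcm_Suc
    by (auto simp: lcm_pos_int simp del: lucas.simps)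
qed

text \<open>The index 1 is left out: for a sign \<open>t 1\<close> the number
  \<open>lucas 1 + t 1\<close> is 0 or 2, and in the first case its cover would be all of the
  natural numbers.\<close>

definition shifted_lucas_support :: "(nat \<Rightarrow> int) \<Rightarrow> nat \<Rightarrow> nat set" where
  "shifted_lucas_support t n = (\<Union>k\<in>{2..n}. shifted_lucas_cover k (t k))"

lemma shifted_lucas_support_subset: "shifted_lucas_support t n \<subseteq> {1..3 * n}"
proof -
  have "shifted_lucas_cover k (t k) \<subseteq> {1..3 * n}" if "k \<in> {2..n}" for k
    using shifted_lucas_cover_finite(2)[of k "t k"] that by fastforce
  then show ?thesis unfolding shifted_lucas_support_def by blast
qed

text \<open>Each term with k >= 2 is the product of \<open>fib_prim\<close> over its cover times a
  cofactor \<open>E k\<close> of logarithm at most 8 ln (3 n). From below, pairwise coprimality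
  makes the product over the whole support divide the lcm. From above, the lcm divides that product
  times all the cofactors, times 2 to account for k = 1.\<close>

lemma ln_shifted_lucas_lcm_bounds:
  assumes t: "\<And>k. k \<in> {1..n} \<Longrightarrow> t k \<in> {-1, 1}" and n: "n > 0"
  defines "S \<equiv> \<Sum>d\<in>shifted_lucas_support t n. ln_fib_prim d"
  shows "S \<le> ln (real_of_int (shifted_lucas_lcm t n))"
    and "ln (real_of_int (shifted_lucas_lcm t n)) \<le> S + 8 * real n * ln (real (3 * n)) + ln 2"
proof -
  let ?D = "shifted_lucas_support t n"
  let ?c = "\<lambda>k. shifted_lucas_cover k (t k)"
  have finD: "finite ?D" and D0: "0 \<notin> ?D"
    using shifted_lucas_support_subset[of t n] by (auto intro: finite_subset)
  have "\<forall>k\<in>{2..n}. \<exists>E. lucas k + t k = int ((\<Prod>d\<in>?c k. fib_prim d) * E) \<and> E > 0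
      \<and> ln (real E) \<le> 8 * ln (real (3 * n))"
  proof
    fix k assume k: "k \<in> {2..n}"
    then obtain x where x: "lucas k + t k = int x" "x > 0" "(\<Prod>d\<in>?c k. fib_prim d) dvd x"
      "ln (real x) \<le> (\<Sum>d\<in>?c k. ln_fib_prim d) + 8 * ln (real (3 * k))"
      using shifted_lucas_factor[of k "t k"] t[of k] by auto
    from x(3) obtain E where E: "x = (\<Prod>d\<in>?c k. fib_prim d) * E" by (elim dvdE)
    have P: "(\<Prod>d\<in>?c k. fib_prim d) > 0" using fib_prim_pos by (intro prod_pos) auto
    have "E > 0" using x(2) E by (auto intro!: Nat.gr0I)
    have "ln (real x) = ln (real (\<Prod>d\<in>?c k. fib_prim d)) + ln (real E)"
      unfolding E of_nat_mult by (rule ln_mult_pos) (use P \<open>E > 0\<close> in \<open>simp_all only: of_nat_0_less_iff\<close>)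
    also have "ln (real (\<Prod>d\<in>?c k. fib_prim d)) = (\<Sum>d\<in>?c k. ln_fib_prim d)"
      using k by (intro ln_prod_fib_prim shifted_lucas_cover_finite) auto
    finally have "ln (real E) \<le> 8 * ln (real (3 * k))" using x(4) by linarith
    also have "\<dots> \<le> 8 * ln (real (3 * n))" using k by simp
    finally show "\<exists>E. lucas k + t k = int ((\<Prod>d\<in>?c k. fib_prim d) * E) \<and> E > 0
      \<and> ln (real E) \<le> 8 * ln (real (3 * n))"
      using x(1) \<open>E > 0\<close> unfolding E by blast
  qed
  then obtain E where E: "\<And>k. k \<in> {2..n} \<Longrightarrow> lucas k + t k = int ((\<Prod>d\<in>?c k. fib_prim d) * E k)"
    "\<And>k. k \<in> {2..n} \<Longrightarrow> E k > 0" "\<And>k. k \<in> {2..n} \<Longrightarrow> ln (real (E k)) \<le> 8 * ln (real (3 * n))"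
    by metis
  obtain l where l: "shifted_lucas_lcm t n = int l" "l > 0"
    using shifted_lucas_lcm_pos by (metis zero_less_imp_eq_int)
  have P: "(\<Prod>d\<in>?D. fib_prim d) > 0" using fib_prim_pos by (intro prod_pos) auto
  have "(\<Prod>d\<in>?D. fib_prim d) dvd l"
  proof (rule prod_fib_prim_dvd[OF finD D0])
    fix d assume "d \<in> ?D"
    then obtain k where k: "k \<in> {2..n}" "d \<in> ?c k" unfolding shifted_lucas_support_def by auto
    have "fib_prim d dvd (\<Prod>d\<in>?c k. fib_prim d)"
      using k shifted_lucas_cover_finite(1)[of k "t k"] by (intro dvd_prodI) auto
    then have "int (fib_prim d) dvd int ((\<Prod>d\<in>?c k. fib_prim d) * E k)"
      unfolding int_dvd_int_iff by (rule dvd_mult2)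
    also have "\<dots> dvd shifted_lucas_lcm t n"
    proof -
      have "(\<Prod>d\<in>?c k. fib_prim d) * E k > 0"
        using E(2)[OF k(1)] fib_prim_pos by (simp add: prod_pos)
      then have "lucas k + t k \<noteq> 0" unfolding E(1)[OF k(1)] by (simp only: of_nat_eq_0_iff)
      then show ?thesis unfolding shifted_lucas_lcm_def E(1)[OF k(1), symmetric] using k(1)
        by (intro dvd_Lcm DiffI imageI) auto
    qed
    finally show "fib_prim d dvd l" unfolding l int_dvd_int_iff .
  qed
  then have "(\<Prod>d\<in>?D. fib_prim d) \<le> l" using l by (intro dvd_imp_le)
  then have "ln (real (\<Prod>d\<in>?D. fib_prim d)) \<le> ln (real l)"
    by (subst ln_le_cancel_iff) (use P l in \<open>simp_all only: of_nat_0_less_iff of_nat_le_iff\<close>)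
  then show "S \<le> ln (real_of_int (shifted_lucas_lcm t n))"
    unfolding S_def l ln_prod_fib_prim[OF finD] by simp
  let ?B = "2 * ((\<Prod>d\<in>?D. fib_prim d) * (\<Prod>k\<in>{2..n}. E k))"
  have EP: "(\<Prod>k\<in>{2..n}. E k) > 0" using E(2) by (intro prod_pos) auto
  have ln_2_mult: "ln (real (2 * (x * y))) = ln 2 + (ln (real x) + ln (real y))" if "x > 0" "y > 0" for x y :: nat
    using that by (simp add: ln_mult_pos)
  have "shifted_lucas_lcm t n dvd int ?B"
    unfolding shifted_lucas_lcm_def
  proof (rule Lcm_least)
    fix b assume "b \<in> (\<lambda>k. lucas k + t k) ` {1..n} - {0}"
    then obtain k where k: "k \<in> {1..n}" "b = lucas k + t k" "b \<noteq> 0" by auto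
    show "b dvd int ?B"
    proof (cases "k = 1")
      case True
      then have "b = 2" using k t[of k] by auto
      then show ?thesis by simp
    next
      case False
      then have k2: "k \<in> {2..n}" using k by auto
      have "(\<Prod>d\<in>?c k. fib_prim d) dvd (\<Prod>d\<in>?D. fib_prim d)"
        using k2 finD by (intro prod_dvd_prod_subset) (auto simp: shifted_lucas_support_def)
      moreover have "E k dvd (\<Prod>k\<in>{2..n}. E k)" using k2 by (intro dvd_prodI) auto
      ultimately have "(\<Prod>d\<in>?c k. fib_prim d) * E k dvd ?B"
        by (intro dvd_mult mult_dvd_mono)
      then show ?thesis unfolding k(2) E(1)[OF k2] int_dvd_int_iff .
    qed
  qed
  then have "l dvd ?B" unfolding l int_dvd_int_iff .
  then have "l \<le> ?B" by (rule dvd_imp_le) (use P EP in \<open>simp only: nat_0_less_mult_iff simp_thms zero_less_numeral\<close>)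
  then have "real l \<le> real ?B" by (simp only: of_nat_le_iff)
  then have "ln (real l) \<le> ln (real ?B)" using l by (intro ln_mono) simp_all
  also have "\<dots> = ln 2 + (ln (real (\<Prod>d\<in>?D. fib_prim d)) + ln (real (\<Prod>k\<in>{2..n}. E k)))"
    using ln_2_mult[OF P EP] .
  also have "ln (real (\<Prod>k\<in>{2..n}. E k)) = (\<Sum>k\<in>{2..n}. ln (real (E k)))"
    unfolding of_nat_prod using E(2) by (intro ln_prod) (auto simp: less_imp_neq)
  also have "\<dots> \<le> (\<Sum>k\<in>{2..n}. 8 * ln (real (3 * n)))" using E(3) by (rule sum_mono)
  also have "\<dots> = real (n - 1) * (8 * ln (real (3 * n)))" by simp
  also have "\<dots> \<le> real n * (8 * ln (real (3 * n)))"
    using n by (intro mult_right_mono) auto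
  finally show "ln (real_of_int (shifted_lucas_lcm t n)) \<le> S + 8 * real n * ln (real (3 * n)) + ln 2"
    unfolding S_def l ln_prod_fib_prim[OF finD] by simp
qed

text \<open>The condition for some sign to put d into the cover of k. The sign, which varies with d
  and k in a complicated way, has disappeared, and this is what permits counting.\<close>

definition shifted_lucas_active :: "nat \<Rightarrow> nat \<Rightarrow> bool" where
  "shifted_lucas_active d k \<longleftrightarrow>
     (if even k then d dvd 3 * k \<and> \<not> d dvd k else d dvd k - 1 \<or> d dvd k + 1)"

text \<open>For k = 2 m, a common divisor of 2 m and 3 m divides m, so the two signs split the
  condition "d divides 6 m but not 2 m" according to whether d divides 3 m. For k = 2 m + 1 they
  split according to whether d divides m or m + 1; here d >= 3 prevents d from dividing both 2 m and
  2 (m + 1).\<close>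

lemma shifted_lucas_cover_unique_sign:
  assumes d: "d \<ge> 3" and k: "k \<ge> 2"
  shows "\<exists>\<sigma>\<in>{-1, 1}. \<forall>s\<in>{-1, 1}. d \<in> shifted_lucas_cover k s \<longleftrightarrow> shifted_lucas_active d k \<and> s = \<sigma>"
proof -
  define m where "m = k div 2"
  define u :: int where "u = (-1) ^ m"
  have u: "u \<in> {-1, 1}" "- u \<in> {-1, 1}" "u \<noteq> - u" unfolding u_def by (cases "even m"; simp)+
  have s: "s = u \<or> s = - u" if "s \<in> {-1, 1}" for s using that u by auto
  have 6: "d dvd 6 * m" if "d dvd 3 * m" using dvd_mult[OF that, of 2] by simp
  have 3: "d dvd m" if "d dvd 2 * m" "d dvd 3 * m" using dvd_diff_nat[OF that(2,1)] by simp
  have d2: False if "d dvd 2" using dvd_imp_le[OF that] d by simp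
  show ?thesis
  proof (cases "even k")
    case True
    then have k2: "k = 2 * m" by (auto simp: m_def)
    have act: "shifted_lucas_active d k \<longleftrightarrow> d dvd 6 * m \<and> \<not> d dvd 2 * m"
      unfolding shifted_lucas_active_def using True by (simp add: k2)
    have cov: "d \<in> shifted_lucas_cover k u \<longleftrightarrow> d dvd 3 * m \<and> \<not> d dvd m"
      "d \<in> shifted_lucas_cover k (- u) \<longleftrightarrow> d dvd 6 * m \<and> \<not> d dvd 3 * m \<and> \<not> d dvd 2 * m"
      unfolding shifted_lucas_cover_def Let_def m_def[symmetric] u_def[symmetric] using True u by auto
    show ?thesis
    proof (cases "d dvd 3 * m")
      case d3: True
      then have "d \<in> shifted_lucas_cover k u \<longleftrightarrow> shifted_lucas_active d k"
        "\<not> d \<in> shifted_lucas_cover k (- u)"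
        unfolding cov act using 6 3 by auto
      then show ?thesis using u s by (intro bexI[of _ u] ballI) metis+
    next
      case d3: False
      then have "\<not> d \<in> shifted_lucas_cover k u"
        "d \<in> shifted_lucas_cover k (- u) \<longleftrightarrow> shifted_lucas_active d k"
        unfolding cov act by auto
      then show ?thesis using u s by (intro bexI[of _ "- u"] ballI) metis+
    qed
  next
    case False
    then have k2: "k = 2 * m + 1" by (auto simp: m_def)
    have act: "shifted_lucas_active d k \<longleftrightarrow> d dvd 2 * m \<or> d dvd 2 * (m + 1)"
      unfolding shifted_lucas_active_def using False by (simp add: k2)
    have cov: "d \<in> shifted_lucas_cover k u \<longleftrightarrow> d dvd 2 * m \<and> \<not> d dvd m \<or> d dvd 2 * (m + 1) \<and> \<not> d dvd m + 1"
      "d \<in> shifted_lucas_cover k (- u) \<longleftrightarrow> d dvd m \<or> d dvd m + 1"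
      unfolding shifted_lucas_cover_def Let_def m_def[symmetric] u_def[symmetric] using False u by auto
    have not_both: False if "d dvd 2 * m" "d dvd 2 * (m + 1)"
      using dvd_diff_nat[OF that(2,1)] d2 by simp
    have double: "d dvd 2 * m" if "d dvd m" using that by simp
    have double': "d dvd 2 * (m + 1)" if "d dvd m + 1" using that by (rule dvd_mult)
    show ?thesis
    proof (cases "d dvd m \<or> d dvd m + 1")
      case d3: True
      then have "\<not> d \<in> shifted_lucas_cover k u"
        "d \<in> shifted_lucas_cover k (- u) \<longleftrightarrow> shifted_lucas_active d k"
        unfolding cov act using not_both double double' by blast+
      then show ?thesis using u s by (intro bexI[of _ "- u"] ballI) metis+
    next
      case d3: False
      then have "d \<in> shifted_lucas_cover k u \<longleftrightarrow> shifted_lucas_active d k"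
        "\<not> d \<in> shifted_lucas_cover k (- u)"
        unfolding cov act by blast+
      then show ?thesis using u s by (intro bexI[of _ u] ballI) metis+
    qed
  qed
qed

lemma multiples_image:
  assumes "D > 0"
  shows "{j \<in> {1..x}. D dvd j} = (\<lambda>i. D * i) ` {1..x div (D::nat)}"
proof (intro equalityI subsetI)
  fix j assume "j \<in> {j \<in> {1..x}. D dvd j}"
  then obtain i where i: "j = D * i" "1 \<le> j" "j \<le> x" by (auto elim: dvdE)
  have "i \<noteq> 0" using i by (cases "i = 0") auto
  moreover have "i \<le> x div D" using i assms by (simp add: less_eq_div_iff_mult_less_eq mult.commute)
  ultimately show "j \<in> (\<lambda>i. D * i) ` {1..x div D}" using i by auto
qed (use assms in \<open>auto simp: less_eq_div_iff_mult_less_eq mult.commute\<close>)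

lemma card_multiples:
  assumes "D > 0"
  shows "card {j \<in> {1..x}. D dvd j} = x div (D::nat)"
  unfolding multiples_image[OF assms] using assms by (subst card_image) (auto intro: inj_onI)

text \<open>With D = lcm d 2 the summands count the k with D dividing k - 1, those with D dividing k
  + 1, and those that are multiples of D / 3 but not of D.\<close>

definition shifted_lucas_count :: "nat \<Rightarrow> nat \<Rightarrow> nat" where
  "shifted_lucas_count n D = (n - 1) div D + (n + 1) div D
     + (if 3 dvd D then 3 * n div D - n div D else 0)"

text \<open>Replacing d by D = lcm d 2 absorbs the parity of k: D divides k - 1 or k + 1 only for
  odd k, and 3 k only for even k. The three classes are disjoint because D >= 3.\<close>

lemma card_shifted_lucas_active:
  assumes d: "d \<ge> 3"
  shows "card {k \<in> {2..n}. shifted_lucas_active d k} = shifted_lucas_count n (lcm d 2)"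
proof -
  define D where "D = lcm d 2"
  have D_dvd: "D dvd j \<longleftrightarrow> d dvd j \<and> even j" for j unfolding D_def by (rule lcm_least_iff)
  have "D > 0" using d by (simp add: D_def lcm_pos_nat)
  moreover have "d dvd D" "even D" by (simp_all add: D_def)
  ultimately have D3: "D \<ge> 3" using d dvd_imp_le[of d D] by linarith
  define A B C where "A = {k \<in> {2..n}. D dvd k - 1}" and "B = {k \<in> {2..n}. D dvd k + 1}"
    and "C = {k \<in> {2..n}. D dvd 3 * k \<and> \<not> D dvd k}"
  have "{k \<in> {2..n}. shifted_lucas_active d k} = A \<union> B \<union> C"
    unfolding A_def B_def C_def shifted_lucas_active_def D_dvd
    by (auto split: if_splits)
  moreover have "A \<inter> B = {}"
  proof -
    have False if "k \<in> A" "k \<in> B" for k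
    proof -
      have "k + 1 - (k - 1) = 2" using that unfolding A_def by auto
      then have "D dvd 2" using dvd_diff_nat[of D "k + 1" "k - 1"] that unfolding A_def B_def by auto
      then show False using D3 dvd_imp_le[of D 2] by simp
    qed
    then show ?thesis by blast
  qed
  moreover have "(A \<union> B) \<inter> C = {}"
  proof -
    have "odd k" if "k \<in> A \<union> B" for k using that unfolding A_def B_def D_dvd by auto
    moreover have "even k" if "k \<in> C" for k using that unfolding C_def D_dvd by auto
    ultimately show ?thesis by blast
  qed
  ultimately have "card {k \<in> {2..n}. shifted_lucas_active d k} = card A + card B + card C"
    by (simp add: card_Un_disjoint A_def B_def C_def)
  moreover have "card A = (n - 1) div D"
  proof -
    have "A = Suc ` {j \<in> {1..n - 1}. D dvd j}"
    proof (intro equalityI subsetI)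
      fix k assume k: "k \<in> A"
      then have "k = Suc (k - 1)" "k - 1 \<in> {j \<in> {1..n - 1}. D dvd j}" unfolding A_def by auto
      then show "k \<in> Suc ` {j \<in> {1..n - 1}. D dvd j}" by (rule image_eqI)
    qed (auto simp: A_def)
    then have "card A = card {j \<in> {1..n - 1}. D dvd j}" by (simp add: card_image)
    then show ?thesis using card_multiples[OF \<open>D > 0\<close>, of "n - 1"] by (simp only:)
  qed
  moreover have "card B = (n + 1) div D"
  proof -
    have "Suc ` B = {j \<in> {1..n + 1}. D dvd j}"
    proof (intro equalityI subsetI)
      fix j assume j: "j \<in> {j \<in> {1..n + 1}. D dvd j}"
      \<comment> \<open>D >= 3 makes the restriction k >= 2 automatic for k = j - 1.\<close>
      then have "j \<ge> 3" using D3 dvd_imp_le[of D j] by auto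
      then have "j = Suc (j - 1)" "j - 1 \<in> B" using j unfolding B_def by auto
      then show "j \<in> Suc ` B" by (rule image_eqI)
    qed (auto simp: B_def)
    then have "card (Suc ` B) = (n + 1) div D" using \<open>D > 0\<close> by (simp only: card_multiples)
    then show ?thesis by (simp add: card_image)
  qed
  moreover have "card C = (if 3 dvd D then 3 * n div D - n div D else 0)"
  proof (cases "3 dvd D")
    case True
    then obtain e where e: "D = 3 * e" by (elim dvdE)
    then have "e > 0" using \<open>D > 0\<close> by simp
    have "C = {j \<in> {1..n}. e dvd j} - {j \<in> {1..n}. D dvd j}"
    proof -
      \<comment> \<open>D / 3 is still even, so its multiples avoid k = 1.\<close>
      have "k \<ge> 2" if "e dvd k" "k \<ge> 1" for k
      proof -
        have "even e" using \<open>even D\<close> e by simp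
        then have "even k" using that by (auto intro: dvd_trans)
        then show ?thesis using that by (cases "k = 1") auto
      qed
      then show ?thesis unfolding C_def e by auto
    qed
    moreover have "{j \<in> {1..n}. D dvd j} \<subseteq> {j \<in> {1..n}. e dvd j}" unfolding e by auto
    ultimately have "card C = n div e - n div D"
      using card_multiples[OF \<open>D > 0\<close>, of n] card_multiples[OF \<open>e > 0\<close>, of n]
      by (simp add: card_Diff_subset)
    also have "n div e = 3 * n div D" unfolding e by (simp add: div_mult2_eq)
    finally show ?thesis using True by simp
  next
    case False
    then have "coprime D 3"
      using prime_imp_coprime[of "3::nat" D] by (simp add: coprime_commute)
    then have "C = {}" unfolding C_def by (auto simp: coprime_dvd_mult_right_iff)
    then show ?thesis using False by simp
  qed
  ultimately show ?thesis unfolding shifted_lucas_count_def D_def[symmetric] by simp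
qed

section \<open>Random signs\<close>

lemma measurable_count_space_binary:
  fixes f :: "'a \<Rightarrow> 'b :: countable" and g :: "'a \<Rightarrow> 'c :: countable"
  assumes f: "f \<in> measurable M (count_space UNIV)" and g: "g \<in> measurable M (count_space UNIV)"
  shows "(\<lambda>\<omega>. h (f \<omega>) (g \<omega>)) \<in> measurable M (count_space UNIV)"
proof (rule measurable_compose_countable[OF _ f, of "\<lambda>i \<omega>. h i (g \<omega>)"])
  show "(\<lambda>\<omega>. h i (g \<omega>)) \<in> measurable M (count_space UNIV)" for i
    using measurable_compose[OF g, of "h i"] by simp
qed

locale random_signs = prob_space M for M :: "'a measure" +
  fixes s :: "nat \<Rightarrow> 'a \<Rightarrow> int"
  assumes indep: "indep_vars (\<lambda>_. count_space UNIV) s {1..}"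
    and distr_sign: "\<And>n. n \<ge> 1 \<Longrightarrow> distr M (count_space UNIV) (s n) = measure_pmf (pmf_of_set {-1, 1})"
begin

lemma measurable_sign: "n \<ge> 1 \<Longrightarrow> s n \<in> measurable M (count_space UNIV)"
  using indep unfolding indep_vars_def2 by simp

lemma prob_sign_neq:
  assumes "n \<ge> 1" "\<sigma> \<in> {-1, 1}"
  shows "prob (s n -` (- {\<sigma>}) \<inter> space M) = 1 / 2"
proof -
  have "prob (s n -` (- {\<sigma>}) \<inter> space M) = measure (distr M (count_space UNIV) (s n)) (- {\<sigma>})"
    using measurable_sign[OF assms(1)] by (intro measure_distr[symmetric]) auto
  also have "\<dots> = real (card ({-1, 1} \<inter> - {\<sigma>})) / real (card {-1, 1 :: int})"
    unfolding distr_sign[OF assms(1)] by (intro measure_pmf_of_set) auto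
  also have "{-1, 1} \<inter> - {\<sigma>} = {- \<sigma>}" using assms(2) by auto
  finally show ?thesis by simp
qed

lemma AE_sign: "n \<ge> 1 \<Longrightarrow> AE \<omega> in M. s n \<omega> \<in> {-1, 1}"
proof -
  assume n: "n \<ge> 1"
  have "AE x in measure_pmf (pmf_of_set {-1, 1 :: int}). x \<in> {-1, 1}"
    by (intro AE_pmfI) simp
  then have "AE x in distr M (count_space UNIV) (s n). x \<in> {-1, 1}"
    unfolding distr_sign[OF n] .
  then show ?thesis using measurable_sign[OF n] by (subst (asm) AE_distr_iff) auto
qed

lemma prob_signs_avoid:
  assumes "finite H" "H \<subseteq> {1..}" "\<And>k. k \<in> H \<Longrightarrow> \<sigma> k \<in> {-1, 1}"
  shows "prob {\<omega> \<in> space M. \<forall>k\<in>H. s k \<omega> \<noteq> \<sigma> k} = (1 / 2) ^ card H"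
proof (cases "H = {}")
  case True
  then show ?thesis by (simp add: prob_space)
next
  case False
  have "{\<omega> \<in> space M. \<forall>k\<in>H. s k \<omega> \<noteq> \<sigma> k} = (\<Inter>k\<in>H. s k -` (- {\<sigma> k}) \<inter> space M)"
    using False by auto
  also have "prob \<dots> = (\<Prod>k\<in>H. prob (s k -` (- {\<sigma> k}) \<inter> space M))"
    using assms False by (intro indep_varsD[OF indep]) auto
  also have "\<dots> = (\<Prod>k\<in>H. 1 / 2)"
    using assms by (intro prod.cong prob_sign_neq) auto
  finally show ?thesis by simp
qed

lemma measurable_shifted_lucas_lcm:
  "(\<lambda>\<omega>. shifted_lucas_lcm (\<lambda>k. s k \<omega>) n) \<in> measurable M (count_space UNIV)"
proof (induction n)
  case 0
  then show ?case by (simp add: shifted_lucas_lcm_def)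
next
  case (Suc n)
  show ?case unfolding shifted_lucas_lcm_Suc
    using measurable_count_space_binary[OF measurable_sign Suc,
        of "Suc n" "\<lambda>x y. if lucas (Suc n) + x = 0 then y else lcm (lucas (Suc n) + x) y"]
    by simp
qed

lemma measurable_ln_shifted_lucas_lcm:
  "(\<lambda>\<omega>. ln (real_of_int (shifted_lucas_lcm (\<lambda>k. s k \<omega>) n))) \<in> borel_measurable M"
  using measurable_compose[OF measurable_shifted_lucas_lcm, of "\<lambda>x. ln (real_of_int x)" borel n] by simp

text \<open>The bounds for fixed signs hold almost surely and the main term in them is a finite sum
  of weighted indicators, so only the probabilities of single events enter. The sum may start at 3,
  where the sign is unique, because F 1 = F 2 = 1 makes the earlier terms 0.\<close>

lemma expectation_ln_shifted_lucas_lcm: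
  assumes n: "n > 0"
  shows "\<bar>expectation (\<lambda>\<omega>. ln (real_of_int (shifted_lucas_lcm (\<lambda>k. s k \<omega>) n)))
      - (\<Sum>d\<in>{3..3 * n}. ln_fib_prim d * (1 - (1 / 2) ^ shifted_lucas_count n (lcm d 2)))\<bar>
    \<le> 8 * real n * ln (real (3 * n)) + ln 2"
proof -
  define X where "X = (\<lambda>\<omega>. ln (real_of_int (shifted_lucas_lcm (\<lambda>k. s k \<omega>) n)))"
  define K where "K = 8 * real n * ln (real (3 * n)) + ln 2"
  have "\<exists>\<sigma>. d \<ge> 3 \<and> k \<ge> 2 \<longrightarrow> \<sigma> \<in> {-1, 1} \<and>
      (\<forall>s\<in>{-1, 1}. d \<in> shifted_lucas_cover k s \<longleftrightarrow> shifted_lucas_active d k \<and> s = \<sigma>)" for d k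
    using shifted_lucas_cover_unique_sign[of d k] by blast
  then obtain \<sigma> where "\<And>d k. d \<ge> 3 \<and> k \<ge> 2 \<longrightarrow> \<sigma> d k \<in> {-1, 1} \<and>
      (\<forall>s\<in>{-1, 1}. d \<in> shifted_lucas_cover k s \<longleftrightarrow> shifted_lucas_active d k \<and> s = \<sigma> d k)"
    by metis
  then have \<sigma>: "\<sigma> d k \<in> {-1, 1}"
    "s \<in> {-1, 1} \<Longrightarrow> d \<in> shifted_lucas_cover k s \<longleftrightarrow> shifted_lucas_active d k \<and> s = \<sigma> d k"
    if "d \<ge> 3" "k \<ge> 2" for d k s
    using that by blast+
  define H where "H = (\<lambda>d. {k \<in> {2..n}. shifted_lucas_active d k})"
  \<comment> \<open>For d >= 3 and almost every outcome, \<open>A d\<close> says that d lies in the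
    random support; the required values \<open>\<sigma> d k\<close> are not random, so independence
    applies to the complement.\<close>
  define A where "A = (\<lambda>d. {\<omega> \<in> space M. \<exists>k\<in>H d. s k \<omega> = \<sigma> d k})"
  define F where "F = (\<lambda>\<omega>. \<Sum>d\<in>{3..3 * n}. ln_fib_prim d * indicator (A d) \<omega>)"
  have H: "finite (H d)" "H d \<subseteq> {1..}" for d unfolding H_def by auto
  have ev: "{\<omega> \<in> space M. \<forall>k\<in>H d. s k \<omega> \<noteq> \<sigma> d k} \<in> events" for d
  proof -
    have "s k -` (- {\<sigma> d k}) \<inter> space M \<in> events" if "k \<in> H d" for k
      using that H(2)[of d] by (intro measurable_sets[OF measurable_sign]) auto
    then have "(\<Inter>k\<in>H d. s k -` (- {\<sigma> d k}) \<inter> space M) \<in> events" if "H d \<noteq> {}"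
      using that H(1)[of d] by (intro sets.finite_INT) auto
    moreover have "{\<omega> \<in> space M. \<forall>k\<in>H d. s k \<omega> \<noteq> \<sigma> d k}
        = (if H d = {} then space M else (\<Inter>k\<in>H d. s k -` (- {\<sigma> d k}) \<inter> space M))"
      by auto
    ultimately show ?thesis by simp
  qed
  have Acompl: "A d = space M - {\<omega> \<in> space M. \<forall>k\<in>H d. s k \<omega> \<noteq> \<sigma> d k}" for d
    unfolding A_def by auto
  have Aev: "A d \<in> events" for d unfolding Acompl using ev by auto
  have probA: "prob (A d) = 1 - (1 / 2) ^ shifted_lucas_count n (lcm d 2)" if "d \<ge> 3" for d
  proof -
    have "prob (A d) = 1 - prob {\<omega> \<in> space M. \<forall>k\<in>H d. s k \<omega> \<noteq> \<sigma> d k}"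
      unfolding Acompl by (rule prob_compl[OF ev])
    also have "prob {\<omega> \<in> space M. \<forall>k\<in>H d. s k \<omega> \<noteq> \<sigma> d k} = (1 / 2) ^ card (H d)"
      using \<sigma>(1)[OF that] by (intro prob_signs_avoid H) (auto simp: H_def)
    also have "card (H d) = shifted_lucas_count n (lcm d 2)"
      unfolding H_def by (rule card_shifted_lucas_active[OF that])
    finally show ?thesis .
  qed
  have Iint: "integrable M (\<lambda>\<omega>. ln_fib_prim d * indicator (A d) \<omega>)" for d
    using Aev[of d] by (intro integrable_mult_right integrable_real_indicator) (auto simp: emeasure_eq_measure)
  have Fint: "integrable M F" unfolding F_def using Iint by (rule Bochner_Integration.integrable_sum)
  have EF: "expectation F = (\<Sum>d\<in>{3..3 * n}. ln_fib_prim d * (1 - (1 / 2) ^ shifted_lucas_count n (lcm d 2)))"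
  proof -
    have "expectation F = (\<Sum>d\<in>{3..3 * n}. ln_fib_prim d * prob (A d))"
      unfolding F_def Bochner_Integration.integral_sum[OF Iint] using Aev by simp
    also have "\<dots> = (\<Sum>d\<in>{3..3 * n}. ln_fib_prim d * (1 - (1 / 2) ^ shifted_lucas_count n (lcm d 2)))"
      using probA by (intro sum.cong) auto
    finally show ?thesis .
  qed
  have "AE \<omega> in M. \<forall>k\<in>{1..n}. s k \<omega> \<in> {-1, 1}"
    using AE_sign by (intro AE_finite_allI) auto
  then have bounds: "AE \<omega> in M. F \<omega> \<le> X \<omega> \<and> X \<omega> \<le> F \<omega> + K"
    using AE_space
  proof eventually_elim
    case (elim \<omega>)
    let ?S = "shifted_lucas_support (\<lambda>k. s k \<omega>) n"
    have mem: "\<omega> \<in> A d \<longleftrightarrow> d \<in> ?S" if "d \<ge> 3" for d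
      using \<sigma>(2)[OF that] elim unfolding A_def H_def shifted_lucas_support_def by auto
    have "(\<Sum>d\<in>?S. ln_fib_prim d) = (\<Sum>d\<in>?S \<inter> {3..3 * n}. ln_fib_prim d)"
    proof (rule sum.mono_neutral_right)
      show "finite ?S" using shifted_lucas_support_subset by (rule finite_subset) simp
      show "\<forall>d\<in>?S - ?S \<inter> {3..3 * n}. ln_fib_prim d = 0"
      proof
        fix d assume "d \<in> ?S - ?S \<inter> {3..3 * n}"
        then have "d = 1 \<or> d = 2" using shifted_lucas_support_subset[of "\<lambda>k. s k \<omega>" n] by fastforce
        then show "ln_fib_prim d = 0" by (auto simp: ln_fib_prim_1 ln_fib_prim_2)
      qed
    qed auto
    also have "\<dots> = (\<Sum>d\<in>{3..3 * n} \<inter> ?S. ln_fib_prim d)" by (simp add: Int_commute)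
    also have "\<dots> = (\<Sum>d\<in>{3..3 * n}. if d \<in> ?S then ln_fib_prim d else 0)"
      by (simp add: sum.inter_restrict)
    also have "\<dots> = F \<omega>" unfolding F_def using mem by (intro sum.cong) (auto simp: indicator_def)
    finally have "F \<omega> = (\<Sum>d\<in>?S. ln_fib_prim d)" ..
    then show ?case
      using ln_shifted_lucas_lcm_bounds[of n "\<lambda>k. s k \<omega>"] elim n unfolding X_def K_def by auto
  qed
  have Xmeas: "X \<in> borel_measurable M" unfolding X_def by (rule measurable_ln_shifted_lucas_lcm)
  have FKint: "integrable M (\<lambda>\<omega>. F \<omega> + K)" using Fint by simp
  have F0: "F \<omega> \<ge> 0" for \<omega> unfolding F_def by (intro sum_nonneg mult_nonneg_nonneg ln_fib_prim_nonneg) simp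
  \<comment> \<open>Almost surely 0 \<le> F \<le> X \<le> F + K, so the integrable F + K dominates
    X.\<close>
  have Xint: "integrable M X"
  proof (rule Bochner_Integration.integrable_bound[OF FKint Xmeas])
    show "AE \<omega> in M. norm (X \<omega>) \<le> norm (F \<omega> + K)"
      using bounds
    proof eventually_elim
      case (elim \<omega>)
      then show ?case using F0[of \<omega>] by auto
    qed
  qed
  have "expectation F \<le> expectation X"
    using bounds by (intro integral_mono_AE Fint Xint) auto
  moreover have "expectation X \<le> expectation (\<lambda>\<omega>. F \<omega> + K)"
    using bounds by (intro integral_mono_AE FKint Xint) auto
  moreover have "expectation (\<lambda>\<omega>. F \<omega> + K) = expectation F + K"
    using Fint by (simp add: prob_space)
  ultimately show ?thesis unfolding X_def[symmetric] K_def[symmetric] EF[symmetric] by linarith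
qed

end

section \<open>Moebius inversion and quadratic asymptotics\<close>

definition moebius_mu :: "nat \<Rightarrow> real" where
  "moebius_mu n = (if squarefree n then (-1) ^ card (prime_factors n) else 0)"

lemma abs_moebius_le: "\<bar>moebius_mu n\<bar> \<le> 1"
  by (simp add: moebius_mu_def power_abs)

lemma moebius_prime_mult:
  assumes "prime p" "\<not> p dvd d" "d > 0"
  shows "moebius_mu (p * d) = - moebius_mu d"
proof -
  have cop: "coprime p d" using assms by (simp add: prime_imp_coprime)
  have "squarefree (p * d) \<longleftrightarrow> squarefree d"
    using cop assms(1) squarefree_mult_coprime[OF cop] squarefree_mono[of d "p * d"] squarefree_prime[of p] by auto
  moreover have "prime_factors (p * d) = insert p (prime_factors d)"
    using assms by (subst prime_factors_product) (auto simp: prime_factorization_prime)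
  moreover have "p \<notin> prime_factors d" using assms by auto
  ultimately show ?thesis by (simp add: moebius_mu_def)
qed

text \<open>For a prime p dividing n, multiplication by p pairs the squarefree divisors prime to p
  with the other squarefree divisors and reverses the sign.\<close>

lemma sum_moebius_divisors:
  assumes "n > 0"
  shows "(\<Sum>d | d dvd n. moebius_mu d) = (if n = 1 then 1 else 0)"
proof (cases "n = 1")
  case True
  then show ?thesis by (simp add: moebius_mu_def)
next
  case False
  then obtain p where p: "prime p" "p dvd n" using prime_factor_nat by blast
  let ?S0 = "{d. d dvd n \<and> squarefree d \<and> \<not> p dvd d}"
  let ?S1 = "{d. d dvd n \<and> squarefree d \<and> p dvd d}"
  have fin: "finite ?S0" "finite ?S1" using assms by (auto intro: finite_subset[OF _ finite_divisors_nat])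
  have S1: "?S1 = (\<lambda>d. p * d) ` ?S0"
  proof (intro equalityI subsetI)
    fix d assume d: "d \<in> ?S1"
    then obtain e where e: "d = p * e" by (auto elim: dvdE)
    have "\<not> p dvd e"
    proof
      assume "p dvd e"
      then have "p ^ 2 dvd d" by (simp add: e power2_eq_square)
      then show False using d p(1) by (auto simp: squarefree_def)
    qed
    moreover have "squarefree e" using d squarefree_mono[of e d] by (simp add: e)
    moreover have "e dvd n" using d by (auto simp: e intro: dvd_mult_right)
    ultimately show "d \<in> (\<lambda>d. p * d) ` ?S0" using e by blast
  next
    fix d assume "d \<in> (\<lambda>d. p * d) ` ?S0"
    then obtain e where e: "d = p * e" "e dvd n" "squarefree e" "\<not> p dvd e" by auto
    have cop: "coprime p e" using p e by (simp add: prime_imp_coprime)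
    show "d \<in> ?S1"
      using e cop p divides_mult[OF p(2) e(2) cop] squarefree_mult_coprime[OF cop] squarefree_prime by auto
  qed
  have "(\<Sum>d | d dvd n. moebius_mu d) = (\<Sum>d\<in>?S0 \<union> ?S1. moebius_mu d)"
    using assms by (intro sum.mono_neutral_right) (auto simp: moebius_mu_def)
  also have "\<dots> = (\<Sum>d\<in>?S0. moebius_mu d) + (\<Sum>d\<in>?S1. moebius_mu d)"
    using fin by (intro sum.union_disjoint) auto
  also have "(\<Sum>d\<in>?S1. moebius_mu d) = (\<Sum>d\<in>?S0. moebius_mu (p * d))"
    unfolding S1 using p by (subst sum.reindex) (auto simp: inj_on_def prime_gt_0_nat)
  also have "\<dots> = (\<Sum>d\<in>?S0. - moebius_mu d)"
    using p assms by (intro sum.cong moebius_prime_mult) (auto intro!: Nat.gr0I)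
  finally show ?thesis using False by (simp add: sum_negf)
qed

text \<open>The substitution n = k d, with the cofactor k becoming the outer variable.\<close>

lemma sum_divisors_hyperbola:
  fixes h :: "nat \<Rightarrow> nat \<Rightarrow> real"
  shows "(\<Sum>n\<in>{1..x}. \<Sum>d | d dvd n. h (n div d) d) = (\<Sum>k\<in>{1..x}. \<Sum>d\<in>{1..x div k}. h k d)"
proof -
  have "(\<Sum>n\<in>{1..x}. \<Sum>d | d dvd n. h (n div d) d) = (\<Sum>(n, d)\<in>(SIGMA n:{1..x}. {d. d dvd n}). h (n div d) d)"
    by (rule sum.Sigma) auto
  also have "\<dots> = (\<Sum>(k, d)\<in>(SIGMA k:{1..x}. {1..x div k}). h k d)"
  proof (rule sum.reindex_bij_witness[where i = "\<lambda>(k, d). (k * d, d)" and j = "\<lambda>(n, d). (n div d, d)"])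
    fix p assume "p \<in> (SIGMA n:{1..x}. {d. d dvd n})"
    then obtain k d where p: "p = (k * d, d)" "1 \<le> k * d" "k * d \<le> x" by (auto elim!: dvdE simp: mult.commute)
    have kd: "k > 0" "d > 0" using p by (auto intro!: Nat.gr0I)
    have "k \<le> k * d" using kd by simp
    then have "k \<le> x" using p by linarith
    moreover have "d \<le> x div k" using kd p by (auto simp: less_eq_div_iff_mult_less_eq mult.commute)
    ultimately show "(case case p of (n, d) \<Rightarrow> (n div d, d) of (k, d) \<Rightarrow> (k * d, d)) = p"
      "(case p of (n, d) \<Rightarrow> (n div d, d)) \<in> (SIGMA k:{1..x}. {1..x div k})"
      "(case case p of (n, d) \<Rightarrow> (n div d, d) of (k, d) \<Rightarrow> h k d) = (case p of (n, d) \<Rightarrow> h (n div d) d)"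
      using kd p by auto
  next
    fix p assume "p \<in> (SIGMA k:{1..x}. {1..x div k})"
    then obtain k d where p: "p = (k, d)" "k > 0" "d > 0" "d \<le> x div k" by auto
    have "k * d \<le> x" using p by (simp add: less_eq_div_iff_mult_less_eq mult.commute)
    moreover have "k \<le> k * d" using p by simp
    then have "k \<le> x" using \<open>k * d \<le> x\<close> by linarith
    moreover have "k * d \<ge> 1" using p by simp
    ultimately show "(case case p of (k, d) \<Rightarrow> (k * d, d) of (n, d) \<Rightarrow> (n div d, d)) = p"
      "(case p of (k, d) \<Rightarrow> (k * d, d)) \<in> (SIGMA n:{1..x}. {d. d dvd n})"
      using p by auto
  qed
  also have "\<dots> = (\<Sum>k\<in>{1..x}. \<Sum>d\<in>{1..x div k}. h k d)"
    by (rule sum.Sigma[symmetric]) auto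
  finally show ?thesis .
qed

section \<open>Passage to the limit in sums over floor quotients\<close>

lemma tannery_sequentially:
  fixes a :: "nat \<Rightarrow> nat \<Rightarrow> real"
  assumes "\<And>k. (\<lambda>n. a k n) \<longlonglongrightarrow> b k" "\<And>k n. \<bar>a k n\<bar> \<le> M k" "summable M"
  shows "(\<lambda>n. \<Sum>k. a k n) \<longlonglongrightarrow> (\<Sum>k. b k)"
proof -
  have "\<forall>\<^sub>F (k, n) in sequentially \<times>\<^sub>F sequentially. norm (a k n) \<le> M k"
    using assms(2) by (auto intro: always_eventually)
  then show ?thesis using tannerys_theorem[of a b sequentially M] assms by auto
qed

lemma quotient_asymptotics:
  assumes "b > 0"
  shows "(\<lambda>n. real (q * n div b) / real n) \<longlonglongrightarrow> real q / real b"
proof (rule tendsto_sandwich)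
  have div: "real (m div b) \<le> real m / real b" "real m / real b - 1 \<le> real (m div b)" for m
  proof -
    show "real (m div b) \<le> real m / real b"
      by (rule of_nat_div_le_of_nat)
    show "real m / real b - 1 \<le> real (m div b)"
    proof -
      have "real m < real (b + m div b * b)"
        using dividend_less_div_times[OF assms, of m] by (simp only: of_nat_less_iff)
      then have "real m < (1 + real (m div b)) * real b" by (simp add: algebra_simps)
      then have "real m / real b < 1 + real (m div b)" using assms by (simp add: pos_divide_less_eq)
      then show ?thesis by linarith
    qed
  qed
  show "\<forall>\<^sub>F n in sequentially. real q / real b - 1 / real n \<le> real (q * n div b) / real n"
    using eventually_gt_at_top[of 0]
  proof eventually_elim
    case (elim n)
    have "(real (q * n) / real b - 1) / real n \<le> real (q * n div b) / real n"
      using div(2)[of "q * n"] by (rule divide_right_mono) simp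
    then show ?case using elim assms by (simp add: field_simps)
  qed
  show "\<forall>\<^sub>F n in sequentially. real (q * n div b) / real n \<le> real q / real b"
    using eventually_gt_at_top[of 0]
  proof eventually_elim
    case (elim n)
    have "real (q * n div b) / real n \<le> (real (q * n) / real b) / real n"
      using div(1)[of "q * n"] by (rule divide_right_mono) simp
    then show ?case using elim assms by (simp add: field_simps)
  qed
  show "(\<lambda>n. real q / real b - 1 / real n) \<longlonglongrightarrow> real q / real b" by real_asymp
qed simp

lemma quotient_at_top:
  assumes "b > 0" "q > 0"
  shows "filterlim (\<lambda>n. q * n div b) at_top sequentially"
proof (rule filterlim_at_top_mono)
  show "filterlim (\<lambda>n. n div b) at_top sequentially"
    unfolding filterlim_at_top
  proof
    fix Z :: nat
    show "\<forall>\<^sub>F n in sequentially. Z \<le> n div b"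
      using eventually_ge_at_top[of "Z * b"]
      by eventually_elim (simp add: assms less_eq_div_iff_mult_less_eq)
  qed
  show "\<forall>\<^sub>F n in sequentially. n div b \<le> q * n div b"
    using assms by (intro always_eventually allI div_le_mono) simp
qed

lemma quadratic_bound:
  fixes A :: "nat \<Rightarrow> real"
  assumes "A 0 = 0" "(\<lambda>y. A y / real y ^ 2) \<longlonglongrightarrow> \<rho>"
  obtains C where "C > 0" "\<And>y. \<bar>A y\<bar> \<le> C * real y ^ 2"
proof -
  have "Bseq (\<lambda>y. A y / real y ^ 2)" using assms(2) by (intro convergent_imp_Bseq convergentI)
  then obtain C where C: "C > 0" "\<And>y. \<bar>A y / real y ^ 2\<bar> \<le> C" by (auto elim!: BseqE)
  have "\<bar>A y\<bar> \<le> C * real y ^ 2" for y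
    using C(2)[of y] assms(1) by (cases "y = 0") (auto simp: abs_divide field_simps)
  then show ?thesis using that C(1) by blast
qed

text \<open>
  The terms with \<open>k = 0\<close> vanish because division by \<open>0\<close> gives \<open>0\<close>.
\<close>
lemma quadratic_tannery:
  fixes A w :: "nat \<Rightarrow> real"
  assumes A0: "A 0 = 0" and A: "(\<lambda>y. A y / real y ^ 2) \<longlonglongrightarrow> \<rho>"
    and w: "summable (\<lambda>k. \<bar>w k\<bar> / real k ^ 2)" and qr: "q > 0" "r > 0"
  shows "(\<lambda>n. (\<Sum>k. w k * A (q * n div (r * k))) / real n ^ 2)
           \<longlonglongrightarrow> (\<Sum>k. w k / real k ^ 2) * (\<rho> * (real q / real r) ^ 2)"
proof -
  obtain C where C: "C > 0" "\<And>y. \<bar>A y\<bar> \<le> C * real y ^ 2"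
    using quadratic_bound[OF A0 A] by blast
  have "(\<lambda>n. \<Sum>k. w k * A (q * n div (r * k)) / real n ^ 2)
      \<longlonglongrightarrow> (\<Sum>k. w k / real k ^ 2 * (\<rho> * (real q / real r) ^ 2))"
  proof (rule tannery_sequentially)
    fix k
    show "(\<lambda>n. w k * A (q * n div (r * k)) / real n ^ 2) \<longlonglongrightarrow> w k / real k ^ 2 * (\<rho> * (real q / real r) ^ 2)"
    proof (cases "k = 0")
      case True
      then show ?thesis by (simp add: A0)
    next
      case False
      then have rk: "r * k > 0" using qr by simp
      let ?y = "\<lambda>n. q * n div (r * k)"
      have top: "filterlim ?y at_top sequentially" by (rule quotient_at_top[OF rk qr(1)])
      \<comment> \<open>With y the floor quotient, A y / n^2 is split as A y / y^2 times (y / n)^2;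
        the y in between cancels once y >= 1.\<close>
      have "(\<lambda>n. w k * (A (?y n) / real (?y n) ^ 2 * (real (?y n) / real n) ^ 2))
          \<longlonglongrightarrow> w k * (\<rho> * (real q / real (r * k)) ^ 2)"
        by (intro tendsto_intros filterlim_compose[OF A top] quotient_asymptotics[OF rk])
      moreover have "\<forall>\<^sub>F n in sequentially. w k * (A (?y n) / real (?y n) ^ 2 * (real (?y n) / real n) ^ 2)
          = w k * A (?y n) / real n ^ 2"
        using filterlim_at_top[THEN iffD1, OF top, rule_format, of 1]
        by eventually_elim (auto simp: power_divide)
      ultimately have "(\<lambda>n. w k * A (?y n) / real n ^ 2) \<longlonglongrightarrow> w k * (\<rho> * (real q / real (r * k)) ^ 2)"
        by (rule Lim_transform_eventually)
      then show ?thesis by (simp add: power_divide power_mult_distrib mult_ac)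
    qed
  next
    fix k n
    have "real (q * n div (r * k)) / real n \<le> real q / real r / real k"
    proof (cases "n = 0")
      case False
      have "real (q * n div (r * k)) / real n \<le> (real (q * n) / real (r * k)) / real n"
        by (intro divide_right_mono of_nat_div_le_of_nat) simp
      then show ?thesis using False by simp
    qed simp
    then have "(real (q * n div (r * k)) / real n) ^ 2 \<le> (real q / real r / real k) ^ 2"
      by (intro power_mono) auto
    then have le: "C * (real (q * n div (r * k)) / real n) ^ 2 \<le> C * (real q / real r / real k) ^ 2"
      using C(1) by (intro mult_left_mono) auto
    have "\<bar>A (q * n div (r * k))\<bar> / real n ^ 2 \<le> C * real (q * n div (r * k)) ^ 2 / real n ^ 2"
      using C(2) by (intro divide_right_mono) auto
    also have "\<dots> = C * (real (q * n div (r * k)) / real n) ^ 2" by (simp add: power_divide)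
    also note le
    finally have "\<bar>w k\<bar> * (\<bar>A (q * n div (r * k))\<bar> / real n ^ 2) \<le> \<bar>w k\<bar> * (C * (real q / real r / real k) ^ 2)"
      by (rule mult_left_mono) simp
    then show "\<bar>w k * A (q * n div (r * k)) / real n ^ 2\<bar> \<le> \<bar>w k\<bar> / real k ^ 2 * (C * (real q / real r) ^ 2)"
      by (simp add: abs_mult power_divide power_mult_distrib mult_ac)
  next
    show "summable (\<lambda>k. \<bar>w k\<bar> / real k ^ 2 * (C * (real q / real r) ^ 2))"
      by (intro summable_mult2 w)
  qed
  moreover have "(\<Sum>k. w k * A (q * n div (r * k)) / real n ^ 2) = (\<Sum>k. w k * A (q * n div (r * k))) / real n ^ 2" for n
  proof (rule suminf_divide)
    show "summable (\<lambda>k. w k * A (q * n div (r * k)))"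
    proof (rule summable_finite[of "{..q * n}"])
      fix k assume "k \<notin> {..q * n}"
      then have "q * n < k" by simp
      also have "k \<le> r * k" using qr by simp
      finally have "q * n < r * k" .
      then show "w k * A (q * n div (r * k)) = 0" using A0 by simp
    qed simp
  qed
  moreover have "(\<Sum>k. w k / real k ^ 2 * (\<rho> * (real q / real r) ^ 2)) = (\<Sum>k. w k / real k ^ 2) * (\<rho> * (real q / real r) ^ 2)"
  proof (rule suminf_mult2[symmetric])
    show "summable (\<lambda>k. w k / real k ^ 2)"
      by (rule summable_rabs_cancel) (use w in \<open>simp add: abs_divide\<close>)
  qed
  ultimately show ?thesis by simp
qed

lemma suminf_quotient_finite:
  fixes A w :: "nat \<Rightarrow> real"
  assumes "A 0 = 0" "r > 0" "m \<le> x"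
  shows "(\<Sum>k. w k * A (m div (r * k))) = (\<Sum>k\<in>{1..x}. w k * A (m div (r * k)))"
proof (rule suminf_finite)
  fix k assume k: "k \<notin> {1..x}"
  then consider "k = 0" | "k > x" by force
  then show "w k * A (m div (r * k)) = 0"
  proof cases
    case 2
    moreover have "k \<le> r * k" using assms by simp
    ultimately have "m < r * k" using assms by linarith
    then show ?thesis using assms by simp
  qed (simp add: assms)
qed simp

lemma inverse_squares_sums': "(\<lambda>k. 1 / real k ^ 2) sums (pi\<^sup>2 / 6)"
  using inverse_squares_sums sums_Suc_iff[of "\<lambda>k. 1 / real k ^ 2" "pi\<^sup>2 / 6"] by (simp add: add.commute)

lemma summable_inverse_squares_bounded:
  fixes w :: "nat \<Rightarrow> real"
  assumes "\<And>k. \<bar>w k\<bar> \<le> 1"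
  shows "summable (\<lambda>k. \<bar>w k\<bar> / real k ^ 2)"
proof (rule summable_comparison_test')
  show "summable (\<lambda>k. 1 / real k ^ 2)" using inverse_squares_sums' by (rule sums_summable)
  show "norm (\<bar>w k\<bar> / real k ^ 2) \<le> 1 / real k ^ 2" if "k \<ge> 0" for k
    using assms[of k] by (simp add: divide_right_mono)
qed

text \<open>A completely multiplicative \<eta> passes through Dirichlet convolution, so one
  inversion serves both the sum over all indices and the sum over those not divisible by 3. The
  indicator of the multiples of 3 is not of this kind, since it is 0 at 1; sums over it are found by
  subtraction.\<close>

locale multiplicative_indicator =
  fixes \<eta> :: "nat \<Rightarrow> real"
  assumes eta_mult: "\<eta> (a * b) = \<eta> a * \<eta> b" and eta_1: "\<eta> 1 = 1" and eta_bounds: "0 \<le> \<eta> a" "\<eta> a \<le> 1"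
begin

text \<open>Grouping by n = k j leaves \<eta> n B n times the sum of the Moebius function over the
  divisors of n, so only n = 1 survives. B is arbitrary because two choices are used: B n = 1 / n^2
  to evaluate the Moebius series, and B n = A (x div n) to invert summatory functions.\<close>

lemma moebius_hyperbola:
  assumes "x > 0"
  shows "(\<Sum>k\<in>{1..x}. moebius_mu k * \<eta> k * (\<Sum>j\<in>{1..x div k}. \<eta> j * B (k * j))) = B 1"
proof -
  have "(\<Sum>k\<in>{1..x}. moebius_mu k * \<eta> k * (\<Sum>j\<in>{1..x div k}. \<eta> j * B (k * j)))
      = (\<Sum>k\<in>{1..x}. \<Sum>j\<in>{1..x div k}. moebius_mu k * (\<eta> (k * j) * B (k * j)))"
    by (simp add: sum_distrib_left eta_mult mult_ac)
  also have "\<dots> = (\<Sum>n\<in>{1..x}. \<Sum>d | d dvd n. moebius_mu (n div d) * (\<eta> (n div d * d) * B (n div d * d)))"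
    by (rule sum_divisors_hyperbola[symmetric])
  also have "\<dots> = (\<Sum>n\<in>{1..x}. if n = 1 then B 1 else 0)"
  proof (intro sum.cong refl)
    fix n assume n: "n \<in> {1..x}"
    have "(\<Sum>d | d dvd n. moebius_mu (n div d) * (\<eta> (n div d * d) * B (n div d * d)))
        = (\<Sum>d | d dvd n. moebius_mu (n div d) * (\<eta> n * B n))"
      by (intro sum.cong) auto
    also have "\<dots> = (\<Sum>d | d dvd n. moebius_mu (n div d)) * (\<eta> n * B n)"
      by (simp add: sum_distrib_right)
    also have "(\<Sum>d | d dvd n. moebius_mu (n div d)) = (\<Sum>d | d dvd n. moebius_mu d)"
      by (rule sum.reindex_bij_witness[where i = "\<lambda>d. n div d" and j = "\<lambda>d. n div d"])
        (use n in \<open>auto elim!: dvdE\<close>)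
    also have "\<dots> = (if n = 1 then 1 else 0)" using n by (intro sum_moebius_divisors) simp
    finally show "(\<Sum>d | d dvd n. moebius_mu (n div d) * (\<eta> (n div d * d) * B (n div d * d)))
        = (if n = 1 then B 1 else 0)"
      using eta_1 by simp
  qed
  also have "\<dots> = B 1" using assms by simp
  finally show ?thesis .
qed

lemma moebius_eta_bound: "\<bar>moebius_mu k * \<eta> k\<bar> \<le> 1"
  using mult_mono[of "\<bar>moebius_mu k\<bar>" 1 "\<eta> k" 1] abs_moebius_le[of k] eta_bounds[of k] by (simp add: abs_mult)

text \<open>With truncations \<open>P\<close> of the series for Z in place of Z,
  \<open>moebius_hyperbola\<close> makes the sum over k exactly 1 for every x > 0. As
  \<open>P\<close> converges to Z and is bounded by Z, Tannery's theorem lets x tend to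
  infinity.\<close>

lemma suminf_moebius:
  assumes Z: "(\<lambda>k. \<eta> k / real k ^ 2) sums Z"
  shows "(\<Sum>k. moebius_mu k * \<eta> k / real k ^ 2) * Z = 1"
proof -
  define P where "P = (\<lambda>y. \<Sum>j\<in>{1..y}. \<eta> j / real j ^ 2)"
  have P_alt: "P y = (\<Sum>j<Suc y. \<eta> j / real j ^ 2)" for y
    unfolding P_def by (rule sum.mono_neutral_left) (auto simp: not_le)
  have Plim: "P \<longlonglongrightarrow> Z"
    unfolding P_alt using Z unfolding sums_def by (rule LIMSEQ_Suc)
  have Pbound: "\<bar>P y\<bar> \<le> Z" for y
  proof -
    have "P y \<le> Z" unfolding P_alt
      using sum_le_suminf[OF sums_summable[OF Z], of "{..<Suc y}"] sums_unique[OF Z] eta_bounds by simp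
    moreover have "P y \<ge> 0" unfolding P_def using eta_bounds by (intro sum_nonneg) auto
    ultimately show ?thesis by simp
  qed
  define m where "m = (\<lambda>k. moebius_mu k * \<eta> k / real k ^ 2)"
  have m: "summable (\<lambda>k. \<bar>m k\<bar>)"
    using summable_inverse_squares_bounded[OF moebius_eta_bound] by (simp add: m_def abs_divide)
  have "(\<lambda>x. \<Sum>k. m k * P (x div k)) \<longlonglongrightarrow> (\<Sum>k. m k * Z)"
  proof (rule tannery_sequentially)
    fix k
    show "(\<lambda>x. m k * P (x div k)) \<longlonglongrightarrow> m k * Z"
    proof (cases "k = 0")
      case True
      then show ?thesis by (simp add: m_def)
    next
      case False
      then have "filterlim (\<lambda>x. x div k) at_top sequentially" using quotient_at_top[of k 1] by simp
      then show ?thesis by (intro tendsto_intros filterlim_compose[OF Plim])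
    qed
  next
    show "\<bar>m k * P (x div k)\<bar> \<le> \<bar>m k\<bar> * Z" for k x
      using Pbound by (simp add: abs_mult mult_left_mono)
    show "summable (\<lambda>k. \<bar>m k\<bar> * Z)" using m by (rule summable_mult2)
  qed
  moreover have "\<forall>\<^sub>F x in sequentially. (\<Sum>k. m k * P (x div k)) = 1"
    using eventually_gt_at_top[of 0]
  proof eventually_elim
    case (elim x)
    have "(\<Sum>k. m k * P (x div k)) = (\<Sum>k\<in>{1..x}. m k * P (x div k))"
      using suminf_quotient_finite[of P 1 x x m] by (simp add: P_def)
    also have "\<dots> = (\<Sum>k\<in>{1..x}. moebius_mu k * \<eta> k * (\<Sum>j\<in>{1..x div k}. \<eta> j * (1 / real (k * j) ^ 2)))"
      unfolding m_def P_def by (simp add: sum_distrib_left power_mult_distrib mult_ac)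
    also have "\<dots> = 1 / real 1 ^ 2" by (rule moebius_hyperbola[OF elim])
    finally show ?case by simp
  qed
  ultimately have "(\<lambda>x. 1) \<longlonglongrightarrow> (\<Sum>k. m k * Z)" by (rule Lim_transform_eventually)
  then have "(\<Sum>k. m k * Z) = 1" by (simp add: LIMSEQ_const_iff)
  moreover have "(\<Sum>k. m k * Z) = (\<Sum>k. m k) * Z"
    by (intro suminf_mult2[symmetric] summable_rabs_cancel[OF m])
  ultimately show ?thesis by (simp add: m_def)
qed

text \<open>
  Only \<open>o(x\<^sup>2)\<close> precision is required of the divisor sums, because the Moebius inversion
  is carried out under Tannery's theorem.
\<close>
lemma sum_from_divisor_sums:
  fixes f :: "nat \<Rightarrow> real"
  assumes G: "(\<lambda>x. (\<Sum>m\<in>{1..x}. \<eta> m * (\<Sum>d | d dvd m. f d)) / real x ^ 2) \<longlonglongrightarrow> \<gamma>"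
    and Z: "(\<lambda>k. \<eta> k / real k ^ 2) sums Z"
  shows "(\<lambda>x. (\<Sum>n\<in>{1..x}. \<eta> n * f n) / real x ^ 2) \<longlonglongrightarrow> \<gamma> / Z"
proof -
  define A where "A = (\<lambda>x::nat. \<Sum>n\<in>{1..x}. \<eta> n * f n)"
  define G' where "G' = (\<lambda>x::nat. \<Sum>m\<in>{1..x}. \<eta> m * (\<Sum>d | d dvd m. f d))"
  have G'_A: "G' y = (\<Sum>j\<in>{1..y}. \<eta> j * A (y div j))" for y
  proof -
    have "G' y = (\<Sum>m\<in>{1..y}. \<Sum>d | d dvd m. \<eta> (m div d) * (\<eta> d * f d))"
      unfolding G'_def sum_distrib_left
    proof (intro sum.cong refl)
      fix m d :: nat assume "d \<in> {d. d dvd m}"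
      then have "\<eta> m = \<eta> (m div d) * \<eta> d" by (simp flip: eta_mult)
      then show "\<eta> m * f d = \<eta> (m div d) * (\<eta> d * f d)" by simp
    qed
    also have "\<dots> = (\<Sum>j\<in>{1..y}. \<Sum>d\<in>{1..y div j}. \<eta> j * (\<eta> d * f d))"
      by (rule sum_divisors_hyperbola)
    also have "\<dots> = (\<Sum>j\<in>{1..y}. \<eta> j * A (y div j))"
      unfolding A_def by (simp add: sum_distrib_left)
    finally show ?thesis .
  qed
  \<comment> \<open>The factors 1 match the shape of \<open>quadratic_tannery\<close> with q = r =
    1.\<close>
  have inv: "(\<Sum>k. (moebius_mu k * \<eta> k) * G' (1 * x div (1 * k))) = A x" for x
  proof (cases "x = 0")
    case True
    then show ?thesis by (simp add: G'_def A_def)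
  next
    case False
    have "(\<Sum>k. (moebius_mu k * \<eta> k) * G' (1 * x div (1 * k))) = (\<Sum>k\<in>{1..x}. moebius_mu k * \<eta> k * G' (x div k))"
      using suminf_quotient_finite[of G' 1 x x "\<lambda>k. moebius_mu k * \<eta> k"] by (simp add: G'_def)
    also have "\<dots> = (\<Sum>k\<in>{1..x}. moebius_mu k * \<eta> k * (\<Sum>j\<in>{1..x div k}. \<eta> j * A (x div (k * j))))"
      unfolding G'_A by (simp add: div_mult2_eq)
    also have "\<dots> = A (x div 1)" using False by (intro moebius_hyperbola[of x "\<lambda>n. A (x div n)"]) simp
    finally show ?thesis by simp
  qed
  have "(\<lambda>x. (\<Sum>k. (moebius_mu k * \<eta> k) * G' (1 * x div (1 * k))) / real x ^ 2)
      \<longlonglongrightarrow> (\<Sum>k. moebius_mu k * \<eta> k / real k ^ 2) * (\<gamma> * (real 1 / real 1) ^ 2)"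
    by (rule quadratic_tannery)
      (use G summable_inverse_squares_bounded[OF moebius_eta_bound] in \<open>auto simp: G'_def\<close>)
  then have "(\<lambda>x. A x / real x ^ 2) \<longlonglongrightarrow> (\<Sum>k. moebius_mu k * \<eta> k / real k ^ 2) * \<gamma>"
    unfolding inv by simp
  moreover have "(\<Sum>k. moebius_mu k * \<eta> k / real k ^ 2) = 1 / Z"
    using suminf_moebius[OF Z] by (metis mult_zero_right nonzero_eq_divide_eq zero_neq_one)
  ultimately show ?thesis by (simp add: A_def)
qed

end

section \<open>The main term\<close>

lemma golden_ratio_power_Suc_Suc: "golden_ratio ^ Suc (Suc n) = golden_ratio ^ Suc n + golden_ratio ^ n"
proof -
  have "golden_ratio ^ Suc (Suc n) = golden_ratio ^ n * golden_ratio ^ 2"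
    by (simp add: power2_eq_square)
  then show ?thesis unfolding golden_ratio_square by (simp add: algebra_simps)
qed

lemma fib_le_golden_power: "real (fib n) \<le> golden_ratio ^ n"
proof (induction n rule: fib.induct)
  case (3 n)
  then show ?case unfolding golden_ratio_power_Suc_Suc by simp
qed (use golden_ratio_gt_1 in auto)

text \<open>The factor \<alpha>^2 is forced by n = 2, where F 2 = 1.\<close>

lemma golden_power_le_fib: "n > 0 \<Longrightarrow> golden_ratio ^ n \<le> golden_ratio ^ 2 * real (fib n)"
proof (induction n rule: fib.induct)
  case 2
  then show ?case using golden_ratio_gt_1 by (simp add: power2_eq_square)
next
  case (3 n)
  show ?case
  proof (cases "n = 0")
    case True
    then show ?thesis by (simp add: power2_eq_square)
  next
    case False
    then show ?thesis using 3 unfolding golden_ratio_power_Suc_Suc by (simp add: algebra_simps)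
  qed
qed simp

lemma ln_golden_ratio_pos: "ln golden_ratio > 0"
  using golden_ratio_gt_1 by simp

lemma ln_fib_le: "n > 0 \<Longrightarrow> ln (real (fib n)) \<le> real n * ln golden_ratio"
  using ln_mono[OF fib_le_golden_power[of n]] golden_ratio_gt_1 by (simp add: fib_pos_iff ln_realpow)

lemma ln_fib_ge:
  assumes "n > 0"
  shows "real n * ln golden_ratio \<le> 2 * ln golden_ratio + ln (real (fib n))"
proof -
  have "ln (golden_ratio ^ n) \<le> ln (golden_ratio ^ 2 * real (fib n))"
    using golden_power_le_fib[OF assms] golden_ratio_gt_1 assms by (intro ln_mono) (auto simp: fib_pos_iff)
  also have "\<dots> = ln (golden_ratio ^ 2) + ln (real (fib n))"
    using golden_ratio_gt_1 assms by (intro ln_mult_pos) (auto simp: fib_pos_iff)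
  finally show ?thesis using golden_ratio_gt_1 by (simp add: ln_realpow)
qed

text \<open>
  Collects the \<open>d\<close> with \<open>lcm d 2 = 2 * e\<close>, which all have the same probability of being missed.
\<close>
definition ln_fib_prim_pair :: "nat \<Rightarrow> real" where
  "ln_fib_prim_pair e = ln_fib_prim (2 * e) + (if odd e then ln_fib_prim e else 0)"

lemma ln_fib_prim_pair_nonneg: "ln_fib_prim_pair e \<ge> 0"
  unfolding ln_fib_prim_pair_def using ln_fib_prim_nonneg by simp

text \<open>A divisor of 2 m is either 2 e with e dividing m or an odd divisor of m. Hence the
  divisor sums of the pairs are again ln F (2 m) up to O(ln m), and Moebius inversion applies to the
  pairs directly.\<close>

lemma sum_ln_fib_prim_pair:
  assumes "m > 0"
  shows "(\<Sum>e | e dvd m. ln_fib_prim_pair e) = sum_ln_fib_prim (2 * m)"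
proof -
  have split: "{d. d dvd 2 * m} = (\<lambda>e. 2 * e) ` {e. e dvd m} \<union> {d. d dvd m \<and> odd d}"
  proof (intro equalityI subsetI)
    fix d assume d: "d \<in> {d. d dvd 2 * m}"
    show "d \<in> (\<lambda>e. 2 * e) ` {e. e dvd m} \<union> {d. d dvd m \<and> odd d}"
    proof (cases "even d")
      case True
      then obtain e where "d = 2 * e" by (elim evenE)
      then show ?thesis using d by auto
    next
      case False
      then have "coprime d 2" by simp
      then show ?thesis using d False by (simp add: coprime_dvd_mult_right_iff)
    qed
  qed auto
  have "sum_ln_fib_prim (2 * m) = (\<Sum>d\<in>(\<lambda>e. 2 * e) ` {e. e dvd m}. ln_fib_prim d)
      + (\<Sum>d | d dvd m \<and> odd d. ln_fib_prim d)"
    unfolding split using assms by (intro sum.union_disjoint) auto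
  also have "(\<Sum>d\<in>(\<lambda>e. 2 * e) ` {e. e dvd m}. ln_fib_prim d) = (\<Sum>e | e dvd m. ln_fib_prim (2 * e))"
    by (subst sum.reindex) (auto simp: inj_on_def)
  also have "(\<Sum>d | d dvd m \<and> odd d. ln_fib_prim d) = (\<Sum>e | e dvd m. if odd e then ln_fib_prim e else 0)"
    using assms by (intro sum.mono_neutral_cong_left) auto
  finally show ?thesis by (simp add: ln_fib_prim_pair_def sum.distrib)
qed

lemma sum_ln_fib_prim_pair_bound:
  assumes "m > 0"
  shows "\<bar>(\<Sum>e | e dvd m. ln_fib_prim_pair e) - 2 * ln golden_ratio * real m\<bar>
    \<le> 2 * ln golden_ratio + 2 * ln (2 * real m)"
  using sum_ln_fib_prim_le[of "2 * m"] ln_fib_le_sum[of "2 * m"] ln_fib_le[of "2 * m"] ln_fib_ge[of "2 * m"]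
    assms ln_golden_ratio_pos ln_ge_zero[of "2 * real m"]
  unfolding sum_ln_fib_prim_pair[OF assms] abs_le_iff by (simp add: algebra_simps)

lemma sum_real_nats: "(\<Sum>m\<in>{1..x}. real m) = real x * (real x + 1) / 2"
  by (induction x) (auto simp: field_simps)

interpretation all: multiplicative_indicator "\<lambda>_. 1"
  by standard auto

interpretation non3: multiplicative_indicator "\<lambda>n. if 3 dvd n then 0 else 1"
proof
  have "prime (3::nat)" by simp
  then show "(if 3 dvd a * b then 0 else 1) = (if 3 dvd a then 0 else 1) * (if 3 dvd b then 0 else (1::real))" for a b :: nat
    by (simp add: prime_dvd_mult_iff)
qed auto

text \<open>Each divisor sum is 2 m ln \<alpha> with an error O(ln m); the errors add up to O(x ln
  x), which is o(x^2).\<close>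

lemma (in multiplicative_indicator) pair_divisor_sum_asymptotics:
  assumes t: "(\<lambda>x. (\<Sum>m\<in>{1..x}. \<eta> m * real m) / real x ^ 2) \<longlonglongrightarrow> t"
  shows "(\<lambda>x. (\<Sum>m\<in>{1..x}. \<eta> m * (\<Sum>e | e dvd m. ln_fib_prim_pair e)) / real x ^ 2)
    \<longlonglongrightarrow> 2 * ln golden_ratio * t"
proof -
  define k where "k = ln golden_ratio"
  define g where "g = (\<lambda>m. \<Sum>e | e dvd m. ln_fib_prim_pair e)"
  define R where "R = (\<lambda>x. (\<Sum>m\<in>{1..x}. \<eta> m * (g m - 2 * k * real m)) / real x ^ 2)"
  have "R \<longlonglongrightarrow> 0"
  proof (rule Lim_null_comparison)
    show "\<forall>\<^sub>F x in sequentially. norm (R x) \<le> real x * (2 * k + 2 * ln (2 * real x)) / real x ^ 2"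
    proof (rule always_eventually, rule allI)
      fix x :: nat
      have "\<bar>\<Sum>m\<in>{1..x}. \<eta> m * (g m - 2 * k * real m)\<bar> \<le> (\<Sum>m\<in>{1..x}. \<bar>\<eta> m * (g m - 2 * k * real m)\<bar>)"
        by (rule sum_abs)
      also have "\<dots> \<le> (\<Sum>m\<in>{1..x}. 2 * k + 2 * ln (2 * real x))"
      proof (rule sum_mono)
        fix m assume m: "m \<in> {1..x}"
        have "\<bar>\<eta> m * (g m - 2 * k * real m)\<bar> \<le> 1 * \<bar>g m - 2 * k * real m\<bar>"
          unfolding abs_mult using eta_bounds[of m] by (intro mult_right_mono) auto
        also have "\<dots> \<le> 2 * k + 2 * ln (2 * real m)"
          using sum_ln_fib_prim_pair_bound[of m] m by (simp add: g_def k_def)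
        also have "\<dots> \<le> 2 * k + 2 * ln (2 * real x)" using m by simp
        finally show "\<bar>\<eta> m * (g m - 2 * k * real m)\<bar> \<le> 2 * k + 2 * ln (2 * real x)" .
      qed
      also have "\<dots> = real x * (2 * k + 2 * ln (2 * real x))" by simp
      finally show "norm (R x) \<le> real x * (2 * k + 2 * ln (2 * real x)) / real x ^ 2"
        by (simp add: R_def abs_divide divide_right_mono)
    qed
    show "(\<lambda>x. real x * (2 * k + 2 * ln (2 * real x)) / real x ^ 2) \<longlonglongrightarrow> 0"
      by real_asymp
  qed
  then have "(\<lambda>x. R x + 2 * k * ((\<Sum>m\<in>{1..x}. \<eta> m * real m) / real x ^ 2)) \<longlonglongrightarrow> 0 + 2 * k * t"
    by (intro tendsto_intros t)
  moreover have "R x + 2 * k * ((\<Sum>m\<in>{1..x}. \<eta> m * real m) / real x ^ 2) = (\<Sum>m\<in>{1..x}. \<eta> m * g m) / real x ^ 2" for x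
    unfolding R_def by (simp add: right_diff_distrib sum_subtractf diff_divide_distrib sum_distrib_left mult_ac)
  ultimately show ?thesis by (simp add: k_def g_def)
qed

lemma sum_nats_asymptotics: "(\<lambda>x. (\<Sum>m\<in>{1..x}. 1 * real m) / real x ^ 2) \<longlonglongrightarrow> 1 / 2"
proof -
  have "(\<lambda>x. (real x * (real x + 1) / 2) / real x ^ 2) \<longlonglongrightarrow> 1 / 2" by real_asymp
  then show ?thesis unfolding mult_1 sum_real_nats .
qed

lemma sum_non3_asymptotics:
  "(\<lambda>x. (\<Sum>m\<in>{1..x}. (if 3 dvd m then 0 else 1) * real m) / real x ^ 2) \<longlonglongrightarrow> 1 / 3"
proof -
  define T where "T = (\<lambda>x. \<Sum>m\<in>{1..x}. real m)"
  have T: "(\<Sum>m\<in>{1..x}. (if 3 dvd m then 0 else 1) * real m) = T x - 3 * T (x div 3)" for x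
  proof -
    have "(\<Sum>m\<in>{1..x}. (if 3 dvd m then 0 else 1) * real m)
        = (\<Sum>m\<in>{1..x}. real m) - (\<Sum>m\<in>{1..x}. if 3 dvd m then real m else 0)"
      unfolding sum_subtractf[symmetric] by (intro sum.cong) auto
    also have "(\<Sum>m\<in>{1..x}. if 3 dvd m then real m else 0) = (\<Sum>m\<in>{m \<in> {1..x}. 3 dvd m}. real m)"
      by (rule sum.inter_filter[symmetric]) simp
    also have "\<dots> = 3 * T (x div 3)"
      unfolding T_def
      by (subst multiples_image, simp, subst sum.reindex) (auto simp: inj_on_def sum_distrib_left)
    finally show ?thesis by (simp add: T_def)
  qed
  define P Q R where "P = (\<lambda>x. T x / real x ^ 2)" and "Q = (\<lambda>x. real (1 * x div 3) / real x)"
    and "R = (\<lambda>x. 1 / real x)"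
  have "P \<longlonglongrightarrow> 1 / 2" using sum_nats_asymptotics by (simp add: P_def T_def)
  moreover have "Q \<longlonglongrightarrow> real 1 / real 3" unfolding Q_def by (rule quotient_asymptotics) simp
  moreover have "R \<longlonglongrightarrow> 0" unfolding R_def by (rule lim_1_over_n)
  \<comment> \<open>For y = x div 3 the multiples of 3 contribute 3 y (y + 1) / 2; divided by x^2
    this is 3 (Q^2 + Q R) / 2.\<close>
  ultimately have "(\<lambda>x. P x - 3 * (Q x ^ 2 + Q x * R x) / 2)
      \<longlonglongrightarrow> 1 / 2 - 3 * ((real 1 / real 3) ^ 2 + (real 1 / real 3) * 0) / 2"
    by (intro tendsto_intros) auto
  moreover have "P x - 3 * (Q x ^ 2 + Q x * R x) / 2 = (T x - 3 * T (x div 3)) / real x ^ 2" for x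
    unfolding P_def Q_def R_def T_def sum_real_nats[of "x div 3"]
    by (cases "x = 0") (simp_all add: field_simps power2_eq_square)
  ultimately show ?thesis unfolding T by (simp add: power2_eq_square)
qed

text \<open>Removing the Euler factor at 3: pi^2 / 6 times 1 - 1/9.\<close>

lemma non3_inverse_squares_sums: "(\<lambda>k. (if 3 dvd k then 0 else 1) / real k ^ 2) sums (4 * pi\<^sup>2 / 27)"
proof -
  have "(\<lambda>k. 1 / 9 * (1 / real k ^ 2)) sums (1 / 9 * (pi\<^sup>2 / 6))"
    by (intro sums_mult inverse_squares_sums')
  moreover have "(\<lambda>k. 1 / 9 * (1 / real k ^ 2)) = (\<lambda>k. if 3 dvd (3 * k) then 1 / real (3 * k) ^ 2 else 0)"
    by (simp add: power_mult_distrib)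
  ultimately have "(\<lambda>k. if 3 dvd k then 1 / real k ^ 2 else 0) sums (1 / 9 * (pi\<^sup>2 / 6))"
    by (subst sums_mono_reindex[of "\<lambda>k. 3 * k", symmetric]) (auto simp: strict_mono_def elim!: dvdE)
  from sums_diff[OF inverse_squares_sums' this]
  have "(\<lambda>k. 1 / real k ^ 2 - (if 3 dvd k then 1 / real k ^ 2 else 0)) sums (4 * pi\<^sup>2 / 27)"
    by simp
  moreover have "(\<lambda>k. 1 / real k ^ 2 - (if 3 dvd k then 1 / real k ^ 2 else 0)) = (\<lambda>k. (if 3 dvd k then 0 else 1) / real k ^ 2)"
    by auto
  ultimately show ?thesis by simp
qed

lemma sum_pair_asymptotics:
  "(\<lambda>x. (\<Sum>e\<in>{1..x}. ln_fib_prim_pair e) / real x ^ 2) \<longlonglongrightarrow> 6 * (ln golden_ratio / pi ^ 2)"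
proof -
  have "(\<lambda>x. (\<Sum>e\<in>{1..x}. 1 * ln_fib_prim_pair e) / real x ^ 2) \<longlonglongrightarrow> 2 * ln golden_ratio * (1 / 2) / (pi\<^sup>2 / 6)"
    by (intro all.sum_from_divisor_sums all.pair_divisor_sum_asymptotics sum_nats_asymptotics inverse_squares_sums')
  then show ?thesis by (simp add: mult.commute)
qed

lemma sum_pair_non3_asymptotics:
  "(\<lambda>x. (\<Sum>e\<in>{1..x}. (if 3 dvd e then 0 else 1) * ln_fib_prim_pair e) / real x ^ 2)
    \<longlonglongrightarrow> 9 / 2 * (ln golden_ratio / pi ^ 2)"
proof -
  have "(\<lambda>x. (\<Sum>e\<in>{1..x}. (if 3 dvd e then 0 else 1) * ln_fib_prim_pair e) / real x ^ 2)
      \<longlonglongrightarrow> 2 * ln golden_ratio * (1 / 3) / (4 * pi\<^sup>2 / 27)"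
    by (intro non3.sum_from_divisor_sums non3.pair_divisor_sum_asymptotics sum_non3_asymptotics
        non3_inverse_squares_sums)
  then show ?thesis by (simp add: mult.commute)
qed

lemma sum_pair_3_asymptotics:
  "(\<lambda>x. (\<Sum>e\<in>{1..x}. (if 3 dvd e then 1 else 0) * ln_fib_prim_pair e) / real x ^ 2)
    \<longlonglongrightarrow> 3 / 2 * (ln golden_ratio / pi ^ 2)"
proof -
  have "(\<lambda>x. (\<Sum>e\<in>{1..x}. ln_fib_prim_pair e) / real x ^ 2
        - (\<Sum>e\<in>{1..x}. (if 3 dvd e then 0 else 1) * ln_fib_prim_pair e) / real x ^ 2)
      \<longlonglongrightarrow> 6 * (ln golden_ratio / pi ^ 2) - 9 / 2 * (ln golden_ratio / pi ^ 2)"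
    by (intro tendsto_diff sum_pair_asymptotics sum_pair_non3_asymptotics)
  moreover have "(\<Sum>e\<in>{1..x}. ln_fib_prim_pair e) / real x ^ 2
        - (\<Sum>e\<in>{1..x}. (if 3 dvd e then 0 else 1) * ln_fib_prim_pair e) / real x ^ 2
      = (\<Sum>e\<in>{1..x}. (if 3 dvd e then 1 else 0) * ln_fib_prim_pair e) / real x ^ 2" for x
    unfolding diff_divide_distrib[symmetric] sum_subtractf[symmetric]
    by (intro arg_cong2[where f = "(/)"] sum.cong) auto
  ultimately show ?thesis by (simp flip: left_diff_distrib)
qed

text \<open>Abel summation: 1 - (1/2)^(g k) telescopes into the sum of the differences w j for 1
  \<le> j \<le> k, starting correctly because g 0 = 0. The condition 2 e j \<le> 3 n is symmetric in
  e and j, so exchanging the sums leaves partial sums of F up to 3 n div (2 j), of size \<rho> (3 n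
  / (2 j))^2; this is the 9/4.\<close>

lemma weighted_sum_asymptotics:
  fixes F :: "nat \<Rightarrow> real" and g :: "nat \<Rightarrow> nat"
  assumes A: "(\<lambda>x. (\<Sum>e\<in>{1..x}. F e) / real x ^ 2) \<longlonglongrightarrow> \<rho>" and g0: "g 0 = 0"
  shows "(\<lambda>n. (\<Sum>e\<in>{1..3 * n}. F e * (1 - (1 / 2) ^ g (3 * n div (2 * e)))) / real n ^ 2)
    \<longlonglongrightarrow> (\<Sum>j. ((1 / 2) ^ g (j - 1) - (1 / 2) ^ g j) / real j ^ 2) * (\<rho> * (9 / 4))"
proof -
  define w :: "nat \<Rightarrow> real" where "w = (\<lambda>j. (1 / 2) ^ g (j - 1) - (1 / 2) ^ g j)"
  define S where "S = (\<lambda>x. \<Sum>e\<in>{1..x}. F e)"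
  have tele: "(\<Sum>j\<in>{1..k}. w j) = 1 - (1 / 2) ^ g k" for k
    by (induction k) (auto simp: w_def g0)
  have w1: "\<bar>w k\<bar> \<le> 1" for k
  proof -
    have "0 \<le> (1 / 2 :: real) ^ i" "(1 / 2 :: real) ^ i \<le> 1" for i by (auto simp: power_le_one)
    from this[of "g (k - 1)"] this[of "g k"] show ?thesis unfolding w_def abs_le_iff by linarith
  qed
  have "(\<Sum>e\<in>{1..3 * n}. F e * (1 - (1 / 2) ^ g (3 * n div (2 * e)))) = (\<Sum>j. w j * S (3 * n div (2 * j)))" for n
  proof -
    have "(\<Sum>e\<in>{1..3 * n}. F e * (1 - (1 / 2) ^ g (3 * n div (2 * e))))
        = (\<Sum>e\<in>{1..3 * n}. \<Sum>j\<in>{j \<in> {1..3 * n}. 2 * e * j \<le> 3 * n}. F e * w j)"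
    proof (intro sum.cong refl)
      fix e assume e: "e \<in> {1..3 * n}"
      have "{1..3 * n div (2 * e)} = {j \<in> {1..3 * n}. 2 * e * j \<le> 3 * n}"
      proof (intro equalityI subsetI)
        fix j assume "j \<in> {1..3 * n div (2 * e)}"
        then have j: "1 \<le> j" "2 * e * j \<le> 3 * n" using e by (auto simp: less_eq_div_iff_mult_less_eq mult_ac)
        have "j \<le> 2 * e * j" using e by simp
        then have "j \<le> 3 * n" using j(2) by (rule le_trans)
        with j show "j \<in> {j \<in> {1..3 * n}. 2 * e * j \<le> 3 * n}" by simp
      qed (use e in \<open>auto simp: less_eq_div_iff_mult_less_eq mult_ac\<close>)
      then show "F e * (1 - (1 / 2) ^ g (3 * n div (2 * e))) = (\<Sum>j\<in>{j \<in> {1..3 * n}. 2 * e * j \<le> 3 * n}. F e * w j)"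
        unfolding tele[symmetric] by (simp only: sum_distrib_left)
    qed
    also have "\<dots> = (\<Sum>j\<in>{1..3 * n}. \<Sum>e\<in>{e \<in> {1..3 * n}. 2 * e * j \<le> 3 * n}. F e * w j)"
      by (rule sum.swap_restrict) auto
    also have "\<dots> = (\<Sum>j\<in>{1..3 * n}. w j * S (3 * n div (2 * j)))"
    proof (intro sum.cong refl)
      fix j assume j: "j \<in> {1..3 * n}"
      have "{1..3 * n div (2 * j)} = {e \<in> {1..3 * n}. 2 * e * j \<le> 3 * n}"
      proof (intro equalityI subsetI)
        fix e assume "e \<in> {1..3 * n div (2 * j)}"
        then have e: "1 \<le> e" "2 * e * j \<le> 3 * n" using j by (auto simp: less_eq_div_iff_mult_less_eq mult_ac)
        have "e \<le> 2 * e * j" using j by simp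
        then have "e \<le> 3 * n" using e(2) by (rule le_trans)
        with e show "e \<in> {e \<in> {1..3 * n}. 2 * e * j \<le> 3 * n}" by simp
      qed (use j in \<open>auto simp: less_eq_div_iff_mult_less_eq mult_ac\<close>)
      then show "(\<Sum>e\<in>{e \<in> {1..3 * n}. 2 * e * j \<le> 3 * n}. F e * w j) = w j * S (3 * n div (2 * j))"
        unfolding S_def by (simp only: sum_distrib_left mult.commute)
    qed
    also have "\<dots> = (\<Sum>j. w j * S (3 * n div (2 * j)))"
      by (rule suminf_quotient_finite[symmetric]) (auto simp: S_def)
    finally show ?thesis .
  qed
  moreover have "(\<lambda>n. (\<Sum>j. w j * S (3 * n div (2 * j))) / real n ^ 2)
      \<longlonglongrightarrow> (\<Sum>j. w j / real j ^ 2) * (\<rho> * (real 3 / real 2) ^ 2)"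
    using A summable_inverse_squares_bounded[of w, OF w1] by (intro quadratic_tannery) (auto simp: S_def)
  ultimately show ?thesis by (simp add: w_def power_divide)
qed

section \<open>Evaluation of the weight series by dilogarithms\<close>

lemma Li2_shifted_summable:
  fixes z a :: real
  assumes "0 \<le> z" "z < 1" "0 \<le> a"
  shows "summable (\<lambda>n. z ^ Suc n / (of_nat (Suc n) + a) ^ 2)"
proof (rule summable_comparison_test')
  show "summable (\<lambda>n. z ^ Suc n)" using assms by (simp add: summable_geometric summable_mult)
  fix n :: nat
  have "1 \<le> (real (Suc n) + a) ^ 2" using assms by (intro one_le_power) simp
  then have "z ^ Suc n / (real (Suc n) + a) ^ 2 \<le> z ^ Suc n / 1"
    using assms by (intro divide_left_mono) auto
  then show "norm (z ^ Suc n / (of_nat (Suc n) + a) ^ 2) \<le> z ^ Suc n"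
    using assms by (simp add: abs_mult power_abs)
qed

lemma Li2_shifted_sums:
  fixes z a :: real
  assumes "0 \<le> z" "z < 1" "0 \<le> a"
  shows "(\<lambda>n. z ^ Suc n / (of_nat (Suc n) + a) ^ 2) sums Li2_shifted z a"
  unfolding Li2_shifted_def by (rule summable_sums[OF Li2_shifted_summable[OF assms]])

lemma Li2_eq_shifted: "Li2 (z :: real) = Li2_shifted z 0"
  by (simp add: Li2_def Li2_shifted_def)

text \<open>Only j = 3 i with i >= 1 contributes; the difference is then 3 (1/4)^i and the
  denominator 9 i^2.\<close>

lemma suminf_weights_non3:
  "(\<Sum>j. ((1 / 2) ^ (2 * ((j - 1) div 3)) - (1 / 2) ^ (2 * (j div 3))) / real j ^ 2) = 1 / 3 * Li2 (1 / 4)"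
proof -
  let ?f = "\<lambda>j::nat. ((1 / 2 :: real) ^ (2 * ((j - 1) div 3)) - (1 / 2) ^ (2 * (j div 3))) / real j ^ 2"
  have "(\<lambda>k. 1 / 3 * ((1 / 4 :: real) ^ Suc k / (of_nat (Suc k) + 0) ^ 2)) sums (1 / 3 * Li2_shifted (1 / 4) 0)"
    by (intro sums_mult Li2_shifted_sums) auto
  moreover have "1 / 3 * ((1 / 4 :: real) ^ Suc k / (of_nat (Suc k) + 0) ^ 2) = ?f (3 * Suc k)" for k
  proof -
    have "(3 * Suc k - 1) div 3 = k" "3 * Suc k div 3 = Suc k" by auto
    moreover have "(1 / 2 :: real) ^ (2 * i) = (1 / 4) ^ i" for i by (simp add: power_mult power2_eq_square)
    ultimately have "?f (3 * Suc k) = ((1 / 4) ^ k - (1 / 4) ^ Suc k) / real (3 * Suc k) ^ 2"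
      by (simp only:)
    also have "\<dots> = 1 / 3 * ((1 / 4) ^ Suc k / (of_nat (Suc k) + 0) ^ 2)"
      unfolding of_nat_mult power_mult_distrib by (simp add: field_simps del: of_nat_Suc)
    finally show ?thesis by (rule sym)
  qed
  ultimately have "(\<lambda>k. ?f (3 * Suc k)) sums (1 / 3 * Li2_shifted (1 / 4) 0)" by simp
  moreover have "?f j = 0" if "j \<notin> range (\<lambda>k. 3 * Suc k)" for j
  proof (cases "j = 0")
    case False
    have "\<not> 3 dvd j"
    proof
      assume "3 dvd j"
      then obtain i where "j = 3 * i" by (elim dvdE)
      then have "j = 3 * Suc (i - 1)" using False by simp
      then show False using that by blast
    qed
    then have "(j - 1) div 3 = j div 3" using False by presburger
    then show ?thesis by simp
  qed simp
  ultimately have "?f sums (1 / 3 * Li2_shifted (1 / 4) 0)"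
    by (subst (asm) sums_mono_reindex[of "\<lambda>k. 3 * Suc k"]) (auto simp: strict_mono_def)
  then show ?thesis unfolding Li2_eq_shifted by (rule sums_unique[symmetric])
qed

text \<open>The exponent grows by 4 over three consecutive j. At j = 3 i, 3 i + 1, 3 i + 2 with i >=
  1 the differences are 3, 1/2 and 1/4 times (1/16)^i, over 9 (i + r/3)^2 for r = 0, 1, 2. The
  initial block has only j = 1 and j = 2 and gives 1/2 + 1/16.\<close>

lemma suminf_weights_3:
  "(\<Sum>j. ((1 / 2) ^ ((j - 1) + (j - 1) div 3) - (1 / 2) ^ (j + j div 3)) / real j ^ 2)
    = 9 / 16 + 1 / 3 * Li2 (1 / 16) + 1 / 18 * Li2_shifted (1 / 16) (1 / 3) + 1 / 36 * Li2_shifted (1 / 16) (2 / 3)"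
proof -
  define w :: "nat \<Rightarrow> real" where "w = (\<lambda>j. (1 / 2) ^ ((j - 1) + (j - 1) div 3) - (1 / 2) ^ (j + j div 3))"
  define f where "f = (\<lambda>j. w j / real j ^ 2)"
  have "\<bar>w k\<bar> \<le> 1" for k
  proof -
    have "0 \<le> (1 / 2 :: real) ^ i" "(1 / 2 :: real) ^ i \<le> 1" for i by (auto simp: power_le_one)
    from this[of "(k - 1) + (k - 1) div 3"] this[of "k + k div 3"] show ?thesis
      unfolding w_def abs_le_iff by linarith
  qed
  then have "summable (\<lambda>k. \<bar>f k\<bar>)"
    unfolding f_def abs_divide using summable_inverse_squares_bounded[of w] by simp
  then have "f sums suminf f" by (rule summable_sums[OF summable_rabs_cancel])
  then have group: "(\<lambda>n. sum f {n * 3..<n * 3 + 3}) sums suminf f" by (rule sums_group) simp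
  have sum3: "sum f {n * 3..<n * 3 + 3} = f (n * 3) + f (n * 3 + 1) + f (n * 3 + 2)" for n
    by (simp add: numeral_3_eq_3)
  have half16: "(1 / 2 :: real) ^ (4 * i) = (1 / 16) ^ i" for i by (simp add: power_mult power4_eq_xxxx)
  define i16 :: "nat \<Rightarrow> real" where "i16 = (\<lambda>n. (1 / 16) ^ Suc n)"
  have f0: "f (Suc n * 3) = 1 / 3 * (i16 n / (of_nat (Suc n) + 0) ^ 2)" for n
  proof -
    have "(Suc n * 3 - 1) + (Suc n * 3 - 1) div 3 = 4 * n + 2" "Suc n * 3 + Suc n * 3 div 3 = 4 * Suc n"
      by auto
    then have "w (Suc n * 3) = (1 / 2) ^ (4 * n + 2) - (1 / 2) ^ (4 * Suc n)" unfolding w_def by (simp only:)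
    also have "\<dots> = 3 * i16 n" unfolding half16 power_add i16_def by (simp add: power2_eq_square)
    finally have w: "w (Suc n * 3) = 3 * i16 n" .
    have sq: "real (Suc n * 3) ^ 2 = 9 * (real (Suc n) + 0) ^ 2"
      by (simp add: power2_eq_square algebra_simps)
    show ?thesis unfolding f_def w sq by (simp del: of_nat_Suc)
  qed
  have f1: "f (Suc n * 3 + 1) = 1 / 18 * (i16 n / (of_nat (Suc n) + 1 / 3) ^ 2)" for n
  proof -
    have "(Suc n * 3 + 1 - 1) + (Suc n * 3 + 1 - 1) div 3 = 4 * Suc n" "Suc n * 3 + 1 + (Suc n * 3 + 1) div 3 = 4 * Suc n + 1"
      by auto
    then have "w (Suc n * 3 + 1) = (1 / 2) ^ (4 * Suc n) - (1 / 2) ^ (4 * Suc n + 1)" unfolding w_def by (simp only:)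
    also have "\<dots> = 1 / 2 * i16 n" unfolding half16 power_add i16_def by simp
    finally have w: "w (Suc n * 3 + 1) = 1 / 2 * i16 n" .
    have sq: "real (Suc n * 3 + 1) ^ 2 = 9 * (real (Suc n) + 1 / 3) ^ 2"
      by (simp add: power2_eq_square algebra_simps)
    show ?thesis unfolding f_def w sq by (simp del: of_nat_Suc)
  qed
  have f2: "f (Suc n * 3 + 2) = 1 / 36 * (i16 n / (of_nat (Suc n) + 2 / 3) ^ 2)" for n
  proof -
    have "(Suc n * 3 + 2 - 1) + (Suc n * 3 + 2 - 1) div 3 = 4 * Suc n + 1" "Suc n * 3 + 2 + (Suc n * 3 + 2) div 3 = 4 * Suc n + 2"
      by auto
    then have "w (Suc n * 3 + 2) = (1 / 2) ^ (4 * Suc n + 1) - (1 / 2) ^ (4 * Suc n + 2)" unfolding w_def by (simp only:)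
    also have "\<dots> = 1 / 4 * i16 n" unfolding half16 power_add i16_def by (simp add: power2_eq_square)
    finally have w: "w (Suc n * 3 + 2) = 1 / 4 * i16 n" .
    have sq: "real (Suc n * 3 + 2) ^ 2 = 9 * (real (Suc n) + 2 / 3) ^ 2"
      by (simp add: power2_eq_square algebra_simps)
    show ?thesis unfolding f_def w sq by (simp del: of_nat_Suc)
  qed
  have start: "sum f {0 * 3..<0 * 3 + 3} = 9 / 16"
    unfolding sum3 by (simp add: f_def w_def power2_eq_square)
  have "(\<lambda>n. sum f {Suc n * 3..<Suc n * 3 + 3}) sums
      (1 / 3 * Li2_shifted (1 / 16) 0 + 1 / 18 * Li2_shifted (1 / 16) (1 / 3) + 1 / 36 * Li2_shifted (1 / 16) (2 / 3))"
    unfolding sum3 f0 f1 f2 i16_def by (intro sums_add sums_mult Li2_shifted_sums) auto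
  then have "(\<lambda>n. sum f {n * 3..<n * 3 + 3}) sums
      (1 / 3 * Li2_shifted (1 / 16) 0 + 1 / 18 * Li2_shifted (1 / 16) (1 / 3) + 1 / 36 * Li2_shifted (1 / 16) (2 / 3)
        + sum f {0 * 3..<0 * 3 + 3})"
    by (subst (asm) sums_Suc_iff)
  from sums_unique2[OF group this[unfolded start]]
  have "suminf f = 9 / 16 + 1 / 3 * Li2 (1 / 16) + 1 / 18 * Li2_shifted (1 / 16) (1 / 3)
      + 1 / 36 * Li2_shifted (1 / 16) (2 / 3)"
    unfolding Li2_eq_shifted by linarith
  then show ?thesis unfolding f_def w_def .
qed

text \<open>The two divisibility hypotheses say that no multiple of 2 e is crossed between n - 1 and
  n + 1, so all three quotients equal k div 3.\<close>

lemma shifted_lucas_count_eq: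
  assumes "n > 0" "e > 0" "\<not> 2 * e dvd n" "\<not> 2 * e dvd n + 1"
  defines "k \<equiv> 3 * n div (2 * e)"
  shows "shifted_lucas_count n (2 * e) = (if 3 dvd e then k + k div 3 else 2 * (k div 3))"
proof -
  have k3: "k div 3 = n div (2 * e)"
    unfolding k_def by (simp add: div_mult2_eq[symmetric] mult.commute[of _ 3])
  have "(n - 1) div (2 * e) = n div (2 * e)"
    using div_Suc[of "n - 1" "2 * e"] assms by (simp add: dvd_eq_mod_eq_0)
  moreover have "(n + 1) div (2 * e) = n div (2 * e)"
    using div_Suc[of n "2 * e"] assms by (simp add: dvd_eq_mod_eq_0)
  moreover have "3 dvd 2 * e \<longleftrightarrow> 3 dvd e" by (simp add: prime_dvd_mult_iff)
  moreover have "k div 3 \<le> k" by simp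
  ultimately show ?thesis
    unfolding shifted_lucas_count_def k_def[symmetric] k3[symmetric] by auto
qed

definition lcm_main_term :: "nat \<Rightarrow> real" where
  "lcm_main_term n = (\<Sum>d\<in>{3..3 * n}. ln_fib_prim d * (1 - (1 / 2) ^ shifted_lucas_count n (lcm d 2)))"

lemma lcm_main_term_pair:
  "lcm_main_term n = (\<Sum>e\<in>{1..3 * n}. ln_fib_prim_pair e * (1 - (1 / 2) ^ shifted_lucas_count n (2 * e)))"
proof -
  define p :: "nat \<Rightarrow> real" where "p = (\<lambda>D. 1 - (1 / 2) ^ shifted_lucas_count n D)"
  \<comment> \<open>No index counts once D > 3 n, which allows the range of e to be extended from 3
    n div 2 to 3 n. For n = 0 this would fail at D = 1.\<close>
  have p0: "p D = 0" if "D > 3 * n" "n > 0" for D using that by (simp add: p_def shifted_lucas_count_def)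
  show ?thesis
  proof (cases "n = 0")
    case True
    then show ?thesis by (simp add: lcm_main_term_def)
  next
    case n: False
    have "lcm_main_term n = (\<Sum>d\<in>{1..3 * n}. ln_fib_prim d * p (lcm d 2))"
      unfolding lcm_main_term_def p_def
    proof (rule sum.mono_neutral_left)
      show "\<forall>d\<in>{1..3 * n} - {3..3 * n}. ln_fib_prim d * (1 - (1 / 2) ^ shifted_lucas_count n (lcm d 2)) = 0"
      proof
        fix d assume "d \<in> {1..3 * n} - {3..3 * n}"
        then have "d = 1 \<or> d = 2" by auto
        then show "ln_fib_prim d * (1 - (1 / 2) ^ shifted_lucas_count n (lcm d 2)) = 0"
          by (auto simp: ln_fib_prim_1 ln_fib_prim_2)
      qed
    qed auto
    also have "\<dots> = (\<Sum>d\<in>{d \<in> {1..3 * n}. 2 dvd d}. ln_fib_prim d * p (lcm d 2))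
        + (\<Sum>d\<in>{d \<in> {1..3 * n}. odd d}. ln_fib_prim d * p (lcm d 2))"
      by (subst sum.union_disjoint[symmetric]) (auto intro!: sum.cong)
    also have "(\<Sum>d\<in>{d \<in> {1..3 * n}. 2 dvd d}. ln_fib_prim d * p (lcm d 2))
        = (\<Sum>e\<in>{1..3 * n div 2}. ln_fib_prim (2 * e) * p (2 * e))"
      by (subst multiples_image, simp, subst sum.reindex) (auto simp: inj_on_def lcm_proj1_if_dvd)
    also have "\<dots> = (\<Sum>e\<in>{1..3 * n}. ln_fib_prim (2 * e) * p (2 * e))"
      using p0 n by (intro sum.mono_neutral_left) auto
    also have "(\<Sum>d\<in>{d \<in> {1..3 * n}. odd d}. ln_fib_prim d * p (lcm d 2))
        = (\<Sum>d\<in>{d \<in> {1..3 * n}. odd d}. ln_fib_prim d * p (2 * d))"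
      by (intro sum.cong refl) (auto simp: lcm_coprime mult.commute)
    also have "\<dots> = (\<Sum>e\<in>{1..3 * n}. if odd e then ln_fib_prim e * p (2 * e) else 0)"
      by (rule sum.inter_filter) simp
    finally have "lcm_main_term n = (\<Sum>e\<in>{1..3 * n}. ln_fib_prim (2 * e) * p (2 * e) + (if odd e then ln_fib_prim e * p (2 * e) else 0))"
      by (simp add: sum.distrib)
    also have "\<dots> = (\<Sum>e\<in>{1..3 * n}. ln_fib_prim_pair e * p (2 * e))"
      by (intro sum.cong) (auto simp: ln_fib_prim_pair_def algebra_simps)
    finally show ?thesis by (simp add: p_def)
  qed
qed

text \<open>The simplified exponent is wrong only if 2 e divides n or n + 1, at a cost of at most
  \<open>ln_fib_prim_pair e\<close>. Summed over the divisors of n and of n + 1 the cost is at most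
  ln F (2 n) + ln F (2 n + 2), which is linear in n.\<close>

lemma lcm_main_term_approx:
  assumes n: "n > 0"
  defines "k \<equiv> \<lambda>e. 3 * n div (2 * e)"
  shows "\<bar>lcm_main_term n
     - ((\<Sum>e\<in>{1..3 * n}. (if 3 dvd e then 0 else 1) * ln_fib_prim_pair e * (1 - (1 / 2) ^ (2 * (k e div 3))))
      + (\<Sum>e\<in>{1..3 * n}. (if 3 dvd e then 1 else 0) * ln_fib_prim_pair e * (1 - (1 / 2) ^ (k e + k e div 3))))\<bar>
    \<le> (4 * real n + 2) * ln golden_ratio"
proof -
  define c where "c = (\<lambda>e. if 3 dvd e then k e + k e div 3 else 2 * (k e div 3))"
  have "(\<Sum>e\<in>{1..3 * n}. (if 3 dvd e then 0 else 1) * ln_fib_prim_pair e * (1 - (1 / 2) ^ (2 * (k e div 3))))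
      + (\<Sum>e\<in>{1..3 * n}. (if 3 dvd e then 1 else 0) * ln_fib_prim_pair e * (1 - (1 / 2) ^ (k e + k e div 3)))
    = (\<Sum>e\<in>{1..3 * n}. ln_fib_prim_pair e * (1 - (1 / 2) ^ c e))"
    unfolding sum.distrib[symmetric] by (intro sum.cong) (auto simp: c_def)
  moreover have "\<bar>lcm_main_term n - (\<Sum>e\<in>{1..3 * n}. ln_fib_prim_pair e * (1 - (1 / 2) ^ c e))\<bar> \<le> (4 * real n + 2) * ln golden_ratio"
  proof -
    have "\<bar>lcm_main_term n - (\<Sum>e\<in>{1..3 * n}. ln_fib_prim_pair e * (1 - (1 / 2) ^ c e))\<bar>
        = \<bar>\<Sum>e\<in>{1..3 * n}. ln_fib_prim_pair e * ((1 / 2) ^ c e - (1 / 2) ^ shifted_lucas_count n (2 * e))\<bar>"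
      unfolding lcm_main_term_pair sum_subtractf[symmetric]
      by (intro arg_cong[where f = abs] sum.cong) (auto simp: algebra_simps)
    also have "\<dots> \<le> (\<Sum>e\<in>{1..3 * n}. \<bar>ln_fib_prim_pair e * ((1 / 2) ^ c e - (1 / 2) ^ shifted_lucas_count n (2 * e))\<bar>)"
      by (rule sum_abs)
    also have "\<dots> \<le> (\<Sum>e\<in>{1..3 * n}. (if e dvd n then ln_fib_prim_pair e else 0) + (if e dvd n + 1 then ln_fib_prim_pair e else 0))"
    proof (rule sum_mono)
      fix e assume e: "e \<in> {1..3 * n}"
      have pow: "0 \<le> (1 / 2 :: real) ^ i" "(1 / 2 :: real) ^ i \<le> 1" for i by (auto simp: power_le_one)
      have "\<bar>(1 / 2 :: real) ^ c e - (1 / 2) ^ shifted_lucas_count n (2 * e)\<bar> \<le> 1"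
        using pow[of "c e"] pow[of "shifted_lucas_count n (2 * e)"] unfolding abs_le_iff by linarith
      then have le: "\<bar>ln_fib_prim_pair e * ((1 / 2) ^ c e - (1 / 2) ^ shifted_lucas_count n (2 * e))\<bar> \<le> ln_fib_prim_pair e"
        using ln_fib_prim_pair_nonneg[of e] by (simp add: abs_mult mult_left_le)
      show "\<bar>ln_fib_prim_pair e * ((1 / 2) ^ c e - (1 / 2) ^ shifted_lucas_count n (2 * e))\<bar>
          \<le> (if e dvd n then ln_fib_prim_pair e else 0) + (if e dvd n + 1 then ln_fib_prim_pair e else 0)"
      proof (cases "2 * e dvd n \<or> 2 * e dvd n + 1")
        case True
        then have "e dvd n \<or> e dvd n + 1" by (auto dest: dvd_mult_right)
        then show ?thesis using le ln_fib_prim_pair_nonneg[of e] by auto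
      next
        case False
        then have "shifted_lucas_count n (2 * e) = c e"
          using shifted_lucas_count_eq[of n e] n e by (auto simp: c_def k_def)
        then show ?thesis using ln_fib_prim_pair_nonneg[of e] by simp
      qed
    qed
    also have "\<dots> = (\<Sum>e\<in>{e \<in> {1..3 * n}. e dvd n}. ln_fib_prim_pair e) + (\<Sum>e\<in>{e \<in> {1..3 * n}. e dvd n + 1}. ln_fib_prim_pair e)"
      unfolding sum.distrib by (intro arg_cong2[where f = "(+)"] sum.inter_filter[symmetric]) simp_all
    also have "\<dots> \<le> (\<Sum>e | e dvd n. ln_fib_prim_pair e) + (\<Sum>e | e dvd n + 1. ln_fib_prim_pair e)"
      using n ln_fib_prim_pair_nonneg by (intro add_mono sum_mono2) auto
    also have "\<dots> = sum_ln_fib_prim (2 * n) + sum_ln_fib_prim (2 * (n + 1))"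
      using sum_ln_fib_prim_pair[OF n] sum_ln_fib_prim_pair[of "n + 1"] by simp
    also have "\<dots> \<le> ln (real (fib (2 * n))) + ln (real (fib (2 * (n + 1))))"
      using n by (intro add_mono sum_ln_fib_prim_le) auto
    also have "\<dots> \<le> real (2 * n) * ln golden_ratio + real (2 * (n + 1)) * ln golden_ratio"
      using n by (intro add_mono ln_fib_le) auto
    finally show ?thesis by (simp add: algebra_simps)
  qed
  ultimately show ?thesis by simp
qed

lemma lcm_main_term_asymptotics:
  "(\<lambda>n. lcm_main_term n / real n ^ 2) \<longlonglongrightarrow> lucas_lcm_const * (ln golden_ratio / pi ^ 2)"
proof -
  define \<beta> where "\<beta> = ln golden_ratio / pi ^ 2"
  define k where "k = (\<lambda>n e::nat. 3 * n div (2 * e))"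
  define U where "U = (\<lambda>n. \<Sum>e\<in>{1..3 * n}. (if 3 dvd e then 0 else 1) * ln_fib_prim_pair e * (1 - (1 / 2) ^ (2 * (k n e div 3))))"
  define V where "V = (\<lambda>n. \<Sum>e\<in>{1..3 * n}. (if 3 dvd e then 1 else 0) * ln_fib_prim_pair e * (1 - (1 / 2) ^ (k n e + k n e div 3)))"
  have U: "(\<lambda>n. U n / real n ^ 2) \<longlonglongrightarrow> 1 / 3 * Li2 (1 / 4) * (9 / 2 * \<beta> * (9 / 4))"
    using weighted_sum_asymptotics[OF sum_pair_non3_asymptotics, of "\<lambda>k. 2 * (k div 3)"]
    unfolding suminf_weights_non3 U_def k_def \<beta>_def by simp
  have V: "(\<lambda>n. V n / real n ^ 2) \<longlonglongrightarrow> (9 / 16 + 1 / 3 * Li2 (1 / 16) + 1 / 18 * Li2_shifted (1 / 16) (1 / 3)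
      + 1 / 36 * Li2_shifted (1 / 16) (2 / 3)) * (3 / 2 * \<beta> * (9 / 4))"
    using weighted_sum_asymptotics[OF sum_pair_3_asymptotics, of "\<lambda>k. k + k div 3"]
    unfolding suminf_weights_3 V_def k_def \<beta>_def by simp
  have "(\<lambda>n. (lcm_main_term n - (U n + V n)) / real n ^ 2) \<longlonglongrightarrow> 0"
  proof (rule Lim_null_comparison)
    define a where "a = ln golden_ratio"
    show "\<forall>\<^sub>F n in sequentially. norm ((lcm_main_term n - (U n + V n)) / real n ^ 2) \<le> (4 * real n + 2) * a / real n ^ 2"
      using eventually_gt_at_top[of 0]
    proof eventually_elim
      case (elim n)
      show ?case
        using divide_right_mono[OF lcm_main_term_approx[OF elim], of "real n ^ 2"]
        by (simp add: U_def V_def k_def abs_divide a_def)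
    qed
    show "(\<lambda>n. (4 * real n + 2) * a / real n ^ 2) \<longlonglongrightarrow> 0" by real_asymp
  qed
  from tendsto_add[OF this tendsto_add[OF U V]]
  have "(\<lambda>n. lcm_main_term n / real n ^ 2) \<longlonglongrightarrow> 0 + (1 / 3 * Li2 (1 / 4) * (9 / 2 * \<beta> * (9 / 4))
      + (9 / 16 + 1 / 3 * Li2 (1 / 16) + 1 / 18 * Li2_shifted (1 / 16) (1 / 3)
      + 1 / 36 * Li2_shifted (1 / 16) (2 / 3)) * (3 / 2 * \<beta> * (9 / 4)))"
    by (simp flip: add_divide_distrib)
  \<comment> \<open>Both 1/3 * 9/2 * 9/4 and 3/2 * 9/4 equal 27/8, and 27/8 * 9/16 =
    243/128.\<close>
  moreover have "0 + (1 / 3 * Li2 (1 / 4) * (9 / 2 * \<beta> * (9 / 4))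
      + (9 / 16 + 1 / 3 * Li2 (1 / 16) + 1 / 18 * Li2_shifted (1 / 16) (1 / 3)
      + 1 / 36 * Li2_shifted (1 / 16) (2 / 3)) * (3 / 2 * \<beta> * (9 / 4))) = lucas_lcm_const * \<beta>"
    unfolding lucas_lcm_const_def by (simp add: algebra_simps)
  ultimately show ?thesis by (simp add: \<beta>_def)
qed

text \<open>A nonzero limit of the quotient by n^2 is what turns convergence into asymptotic
  equivalence.\<close>

lemma lucas_lcm_const_pos: "lucas_lcm_const > 0"
proof -
  have "Li2_shifted z a \<ge> 0" if "0 \<le> z" "z < 1" "0 \<le> a" for z a :: real
    unfolding Li2_shifted_def using that by (intro suminf_nonneg Li2_shifted_summable) auto
  from this[of "1 / 4" 0] this[of "1 / 16" 0] this[of "1 / 16" "1 / 3"] this[of "1 / 16" "2 / 3"]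
  show ?thesis unfolding lucas_lcm_const_def Li2_eq_shifted by simp
qed

theorem theorem1p4:
  fixes M :: "'a measure" and s :: "nat \<Rightarrow> 'a \<Rightarrow> int"
  assumes "prob_space M"
    and "prob_space.indep_vars M (\<lambda>_. count_space UNIV) s {1..}"
    and "\<And>n. n \<ge> 1 \<Longrightarrow> distr M (count_space UNIV) (s n) = measure_pmf (pmf_of_set {-1, 1})"
  shows "(\<lambda>n::nat. prob_space.expectation M
             (\<lambda>\<omega>. ln (real_of_int (shifted_lucas_lcm (\<lambda>k. s k \<omega>) n))))
         \<sim>[at_top] (\<lambda>n. lucas_lcm_const * (ln golden_ratio / pi ^ 2) * real n ^ 2)"
proof -
  interpret prob_space M by (rule assms(1))
  interpret random_signs M s using assms(2,3) by unfold_locales auto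
  define X where "X = (\<lambda>n. expectation (\<lambda>\<omega>. ln (real_of_int (shifted_lucas_lcm (\<lambda>k. s k \<omega>) n))))"
  define L where "L = lucas_lcm_const * (ln golden_ratio / pi ^ 2)"
  have L: "L > 0" unfolding L_def using lucas_lcm_const_pos ln_golden_ratio_pos by simp
  have "(\<lambda>n. (X n - lcm_main_term n) / real n ^ 2) \<longlonglongrightarrow> 0"
  proof (rule Lim_null_comparison)
    show "\<forall>\<^sub>F n in sequentially. norm ((X n - lcm_main_term n) / real n ^ 2)
        \<le> (8 * real n * ln (3 * real n) + ln 2) / real n ^ 2"
      using eventually_gt_at_top[of 0]
    proof eventually_elim
      case (elim n)
      show ?case
        using divide_right_mono[OF expectation_ln_shifted_lucas_lcm[OF elim], of "real n ^ 2"]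
        by (simp add: X_def lcm_main_term_def abs_divide)
    qed
    show "(\<lambda>n. (8 * real n * ln (3 * real n) + ln 2) / real n ^ 2) \<longlonglongrightarrow> 0" by real_asymp
  qed
  from tendsto_add[OF this lcm_main_term_asymptotics]
  have "(\<lambda>n. X n / real n ^ 2) \<longlonglongrightarrow> L"
    by (simp add: L_def flip: add_divide_distrib)
  then have "(\<lambda>n. X n / real n ^ 2 / L) \<longlonglongrightarrow> L / L"
    using L by (intro tendsto_divide tendsto_const) auto
  then have "(\<lambda>n. X n / (L * real n ^ 2)) \<longlonglongrightarrow> 1"
    using L by (simp add: mult.commute)
  then have "X \<sim>[at_top] (\<lambda>n. L * real n ^ 2)"
    using L eventually_gt_at_top[of 0] by (intro asymp_equivI') (auto elim: eventually_mono)
  then show ?thesis by (simp add: X_def L_def)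
qed

end
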